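(* Let $d\geq 3$ be an integer and let $\varrho,\varrho^{*}\in\mathbb{K}$. Then the following (i), (ii) are equivalent. (i) There exists a totally bipartite Leonard pair $A,A^{*}$ of Bannai/Ito type with diameter $d$ that satisfies $$A^{2}A^{*}+2AA^{*}A+A^{*}A^{2}=\varrho A^{*},\qquad A^{*2}A+2A^{*}AA^{*}+AA^{*2}=\varrho^{*}A.$$ (ii) The integer $d$ is even and the scalars $\varrho,\varrho^{*}$ are nonzero. Moreover, if (i), (ii) hold, then the Leonard pair in (i) is unique up to isomorphism of Leonard pairs.
   Context: $\mathbb{K}$ is an algebraically closed field of characteristic zero. A square matrix is tridiagonal if every nonzero entry lies on the diagonal, subdiagonal or superdiagonal; a tridiagonal matrix is irreducible if every subdiagonal and superdiagonal entry is nonzero. A tridiagonal matrix $B$ with rows and columns indexed by $0,\dots,d$ is bipartite if $B_{ii}=0$ for all $i$. Let $V$ be a $\mathbb{K}$-vector space of finite positive dimension. A Leonard pair on $V$ is an ordered pair of linear maps $A,A^*:V\to V$ such that (1) there is a basis $\{v_i\}_{i=0}^d$ of $V$ in which $A$ is diagonal and $A^*$ is irreducible tridiagonal, and (2) there is a basis $\{v^*_i\}_{i=0}^d$ of $V$ in which $A^*$ is diagonal and $A$ is irreducible tridiagonal. Its diameter is $d=\dim V-1$. The Leonard pair is totally bipartite if the matrix of $A^*$ in (1) and the matrix of $A$ in (2) are both bipartite. Let $\theta_i$ be the eigenvalue of $A$ for $v_i$ and $\theta_i^*$ the eigenvalue of $A^*$ for $v_i^*$. It is known that the expressions $\frac{\theta_{i-2}-\theta_{i+1}}{\theta_{i-1}-\theta_i}$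 and $\frac{\theta^*_{i-2}-\theta^*_{i+1}}{\theta^*_{i-1}-\theta^*_i}$ are equal and independent of $i$ for $2\le i\le d-1$; the Leonard pair is of Bannai/Ito type if this common value is $-1$. Leonard pairs $A,A^*$ on $V$ and $B,B^*$ on $W$ are isomorphic if there is a vector space isomorphism $\phi:V\to W$ with $\phi A=B\phi$ and $\phi A^*=B^*\phi$. *)

theory Defs
  imports
    "HOL-Computational_Algebra.Polynomial"
    "HOL-Library.Function_Algebras"
    "Jordan_Normal_Form.Matrix"
begin

definition tridiagonal_mat :: "'k::zero mat \<Rightarrow> bool" where
  "tridiagonal_mat B \<longleftrightarrow> square_mat B \<and>
     (\<forall>i<dim_row B. \<forall>j<dim_col B. B $$ (i, j) \<noteq> 0 \<longrightarrow> i = j \<or> i = Suc j \<or> j = Suc i)"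

definition irreducible_tridiagonal_mat :: "'k::zero mat \<Rightarrow> bool" where
  "irreducible_tridiagonal_mat B \<longleftrightarrow> tridiagonal_mat B \<and>
     (\<forall>i. Suc i < dim_row B \<longrightarrow> B $$ (Suc i, i) \<noteq> 0 \<and> B $$ (i, Suc i) \<noteq> 0)"

definition bipartite_mat :: "'k::zero mat \<Rightarrow> bool" where
  "bipartite_mat B \<longleftrightarrow> tridiagonal_mat B \<and> (\<forall>i<dim_row B. B $$ (i, i) = 0)"

text \<open>
  HOL cannot quantify existentially over types, so a vector space \<open>V\<close> is a subspace of an ambient
  vector space \<open>(scale, 'v)\<close>. A linear map on \<open>V\<close> is a function on \<open>'v\<close> of which only the values
  on \<open>V\<close> matter.
\<close>

definition linear_map_on ::
  "('k \<Rightarrow> 'v \<Rightarrow> 'v) \<Rightarrow> ('k \<Rightarrow> 'w \<Rightarrow> 'w) \<Rightarrow> 'v::plus set \<Rightarrow> 'w::plus set \<Rightarrow> ('v \<Rightarrow> 'w) \<Rightarrow> bool" where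
  "linear_map_on s1 s2 V W f \<longleftrightarrow>
     (\<forall>x\<in>V. f x \<in> W) \<and>
     (\<forall>x\<in>V. \<forall>y\<in>V. f (x + y) = f x + f y) \<and>
     (\<forall>c. \<forall>x\<in>V. f (s1 c x) = s2 c (f x))"

definition isomorphic_pairs ::
  "('k \<Rightarrow> 'v \<Rightarrow> 'v) \<Rightarrow> 'v::plus set \<Rightarrow> ('v \<Rightarrow> 'v) \<Rightarrow> ('v \<Rightarrow> 'v) \<Rightarrow>
   ('k \<Rightarrow> 'w \<Rightarrow> 'w) \<Rightarrow> 'w::plus set \<Rightarrow> ('w \<Rightarrow> 'w) \<Rightarrow> ('w \<Rightarrow> 'w) \<Rightarrow> bool" where
  "isomorphic_pairs s1 V A As s2 W B Bs \<longleftrightarrow>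
     (\<exists>\<phi>. linear_map_on s1 s2 V W \<phi> \<and> bij_betw \<phi> V W \<and>
          (\<forall>x\<in>V. \<phi> (A x) = B (\<phi> x)) \<and> (\<forall>x\<in>V. \<phi> (As x) = Bs (\<phi> x)))"

definition diameter :: "('k::field \<Rightarrow> 'v::ab_group_add \<Rightarrow> 'v) \<Rightarrow> 'v set \<Rightarrow> nat" where
  "diameter scale V = vector_space.dim scale V - 1"

definition indexed_basis ::
  "('k::field \<Rightarrow> 'v::ab_group_add \<Rightarrow> 'v) \<Rightarrow> 'v set \<Rightarrow> (nat \<Rightarrow> 'v) \<Rightarrow> bool" where
  "indexed_basis scale V v \<longleftrightarrow>
     inj_on v {..diameter scale V} \<and>
     \<not> module.dependent scale (v ` {..diameter scale V}) \<and>
     module.span scale (v ` {..diameter scale V}) = V"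

text \<open>The \<open>j\<close>-th column holds the coordinates of \<open>A (v j)\<close>.\<close>

definition matrix_wrt ::
  "('k::field \<Rightarrow> 'v::ab_group_add \<Rightarrow> 'v) \<Rightarrow> 'v set \<Rightarrow> (nat \<Rightarrow> 'v) \<Rightarrow> ('v \<Rightarrow> 'v) \<Rightarrow> 'k mat" where
  "matrix_wrt scale V v A = mat (Suc (diameter scale V)) (Suc (diameter scale V))
     (\<lambda>(i, j). module.representation scale (v ` {..diameter scale V}) (A (v j)) (v i))"

text \<open>Condition (1) for \<open>A, As\<close> asks for some \<open>v\<close> with \<open>standard_basis scale V A As v\<close>, and
  condition (2) for some \<open>vs\<close> with \<open>standard_basis scale V As A vs\<close>.\<close>

definition standard_basis ::
  "('k::field \<Rightarrow> 'v::ab_group_add \<Rightarrow> 'v) \<Rightarrow> 'v set \<Rightarrow> ('v \<Rightarrow> 'v) \<Rightarrow> ('v \<Rightarrow> 'v) \<Rightarrow> (nat \<Rightarrow> 'v) \<Rightarrow> bool"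
  where
  "standard_basis scale V A As v \<longleftrightarrow> indexed_basis scale V v \<and>
     diagonal_mat (matrix_wrt scale V v A) \<and>
     irreducible_tridiagonal_mat (matrix_wrt scale V v As)"

text \<open>\<open>dim\<close> is \<open>0\<close> for infinite-dimensional spaces, so \<open>dim V > 0\<close> says that the dimension is
  finite and positive.\<close>

definition leonard_pair ::
  "('k::field \<Rightarrow> 'v::ab_group_add \<Rightarrow> 'v) \<Rightarrow> 'v set \<Rightarrow> ('v \<Rightarrow> 'v) \<Rightarrow> ('v \<Rightarrow> 'v) \<Rightarrow> bool" where
  "leonard_pair scale V A As \<longleftrightarrow>
     vector_space scale \<and> module.subspace scale V \<and> vector_space.dim scale V > 0 \<and>
     linear_map_on scale scale V V A \<and> linear_map_on scale scale V V As \<and>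
     (\<exists>v. standard_basis scale V A As v) \<and> (\<exists>vs. standard_basis scale V As A vs)"

text \<open>The bases in (1) and (2) are unique up to rescaling the vectors and reversing their order,
  neither of which affects the next two notions; so it does not matter which bases are chosen.\<close>

definition totally_bipartite ::
  "('k::field \<Rightarrow> 'v::ab_group_add \<Rightarrow> 'v) \<Rightarrow> 'v set \<Rightarrow> ('v \<Rightarrow> 'v) \<Rightarrow> ('v \<Rightarrow> 'v) \<Rightarrow> bool" where
  "totally_bipartite scale V A As \<longleftrightarrow>
     (\<exists>v. standard_basis scale V A As v \<and> bipartite_mat (matrix_wrt scale V v As)) \<and>
     (\<exists>vs. standard_basis scale V As A vs \<and> bipartite_mat (matrix_wrt scale V vs A))"

text \<open>For a Leonard pair the quotients below are known to have a common value, and the denominators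
  are nonzero as the eigenvalues of each map are mutually distinct. The notion is meaningful only
  for diameter at least 3; otherwise the index range is empty.\<close>

definition bannai_ito_type ::
  "('k::field \<Rightarrow> 'v::ab_group_add \<Rightarrow> 'v) \<Rightarrow> 'v set \<Rightarrow> ('v \<Rightarrow> 'v) \<Rightarrow> ('v \<Rightarrow> 'v) \<Rightarrow> bool" where
  "bannai_ito_type scale V A As \<longleftrightarrow>
     (\<exists>v vs \<theta> \<theta>s. standard_basis scale V A As v \<and> standard_basis scale V As A vs \<and>
        (\<forall>i\<le>diameter scale V. A (v i) = scale (\<theta> i) (v i)) \<and>
        (\<forall>i\<le>diameter scale V. As (vs i) = scale (\<theta>s i) (vs i)) \<and>
        (\<forall>i\<in>{2..diameter scale V - 1}.
           (\<theta> (i - 2) - \<theta> (i + 1)) / (\<theta> (i - 1) - \<theta> i) = - 1 \<and>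
           (\<theta>s (i - 2) - \<theta>s (i + 1)) / (\<theta>s (i - 1) - \<theta>s i) = - 1))"

definition cubic_relations ::
  "('k::field \<Rightarrow> 'v::ab_group_add \<Rightarrow> 'v) \<Rightarrow> 'k \<Rightarrow> 'k \<Rightarrow> 'v set \<Rightarrow> ('v \<Rightarrow> 'v) \<Rightarrow> ('v \<Rightarrow> 'v) \<Rightarrow> bool"
  where
  "cubic_relations scale \<rho> \<rho>s V A As \<longleftrightarrow>
     (\<forall>x\<in>V. A (A (As x)) + scale 2 (A (As (A x))) + As (A (A x)) = scale \<rho> (As x)) \<and>
     (\<forall>x\<in>V. As (As (A x)) + scale 2 (As (A (As x))) + A (As (As x)) = scale \<rho>s (A x))"

definition tb_bi_leonard_pair ::
  "('k::field \<Rightarrow> 'v::ab_group_add \<Rightarrow> 'v) \<Rightarrow> nat \<Rightarrow> 'k \<Rightarrow> 'k \<Rightarrow>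
   'v set \<Rightarrow> ('v \<Rightarrow> 'v) \<Rightarrow> ('v \<Rightarrow> 'v) \<Rightarrow> bool" where
  "tb_bi_leonard_pair scale d \<rho> \<rho>s V A As \<longleftrightarrow>
     leonard_pair scale V A As \<and> totally_bipartite scale V A As \<and> bannai_ito_type scale V A As \<and>
     diameter scale V = d \<and> cubic_relations scale \<rho> \<rho>s V A As"

text \<open>The space of sequences over \<open>'k\<close>, which contains a copy of every finite-dimensional vector
  space over \<open>'k\<close>.\<close>

definition seq_scale :: "'k::field \<Rightarrow> (nat \<Rightarrow> 'k) \<Rightarrow> (nat \<Rightarrow> 'k)" where
  "seq_scale c f = (\<lambda>n. c * f n)"

lemma vector_space_seq_scale: "vector_space (seq_scale :: 'k::field \<Rightarrow> _)"
  by unfold_locales (auto simp: seq_scale_def fun_eq_iff algebra_simps)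

end

theory Submission
  imports Defs
begin

text \<open>
  In an eigenbasis of \<open>A\<close> in which \<open>As\<close> is bipartite tridiagonal, the first cubic relation says
  \<open>(\<theta> i + \<theta> (i + 1))\<^sup>2 = \<rho>\<close>. As the eigenvalues are distinct, these sums alternate in sign, so
  \<open>\<theta>\<close> is known up to \<open>\<theta> 0\<close>. The second relation is a first-order recurrence for the products
  of opposite off-diagonal entries of \<open>As\<close>; its two boundary conditions determine \<open>\<theta> 0\<close> and all
  the products. For odd \<open>d\<close> the solution has \<open>\<theta> d = \<theta> 0\<close>. For even \<open>d\<close> a rescaled basis brings
  \<open>A, As\<close> to a normal form depending only on square roots of \<open>\<rho> / 4\<close> and \<open>\<rho>s / 4\<close>, and reversing
  the basis changes the sign of the first root. Conversely, the normal form is realised on binary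
  forms of degree \<open>d\<close>, where products of powers of \<open>x + y\<close> and \<open>x - y\<close> give the dual basis.
\<close>

section \<open>Coordinates with respect to an indexed basis\<close>

text \<open>Coordinates are indexed by positions rather than by basis vectors. Beyond the diameter
  the value has no meaning, as \<open>v i\<close> is then arbitrary.\<close>

definition coord ::
  "('k::field \<Rightarrow> 'v::ab_group_add \<Rightarrow> 'v) \<Rightarrow> 'v set \<Rightarrow> (nat \<Rightarrow> 'v) \<Rightarrow> 'v \<Rightarrow> nat \<Rightarrow> 'k" where
  "coord scale V v x i = module.representation scale (v ` {..diameter scale V}) x (v i)"

lemma linear_map_onD:
  assumes "linear_map_on s1 s2 V W f"
  shows "x \<in> V \<Longrightarrow> f x \<in> W"
    and "x \<in> V \<Longrightarrow> y \<in> V \<Longrightarrow> f (x + y) = f x + f y"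
    and "x \<in> V \<Longrightarrow> f (s1 c x) = s2 c (f x)"
  using assms by (auto simp: linear_map_on_def)

lemma sum_up_to_single:
  fixes f :: "nat \<Rightarrow> 'a::comm_monoid_add"
  assumes "j \<le> n" "\<And>i. i \<le> n \<Longrightarrow> i \<noteq> j \<Longrightarrow> f i = 0"
  shows "(\<Sum>i\<le>n. f i) = f j"
  using assms by (subst sum.remove[of _ j]) (auto intro!: sum.neutral)

text \<open>This is the shape of a column of a tridiagonal matrix with zero diagonal: only the two
  neighbours of \<open>j\<close> contribute, and the case distinctions drop a neighbour outside
  \<open>{..n}\<close>.\<close>

lemma sum_up_to_Suc_pred:
  fixes f :: "nat \<Rightarrow> 'a::comm_monoid_add"
  assumes "j \<le> n" "\<And>i. i \<le> n \<Longrightarrow> i \<noteq> Suc j \<Longrightarrow> j \<noteq> Suc i \<Longrightarrow> f i = 0"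
  shows "(\<Sum>i\<le>n. f i) = (if j < n then f (Suc j) else 0) + (if 0 < j then f (j - 1) else 0)"
proof -
  have "(\<Sum>i\<le>n. f i) = (\<Sum>i\<in>(if j < n then {Suc j} else {}) \<union> (if 0 < j then {j - 1} else {}). f i)"
  proof (intro sum.mono_neutral_right ballI)
    fix i assume "i \<in> {..n} - ((if j < n then {Suc j} else {}) \<union> (if 0 < j then {j - 1} else {}))"
    then show "f i = 0"
      using assms(1) by (intro assms(2)) (auto split: if_splits)
  qed (use assms(1) in auto)
  also have "\<dots> = (if j < n then f (Suc j) else 0) + (if 0 < j then f (j - 1) else 0)"
    by (subst sum.union_disjoint) (auto split: if_splits)
  finally show ?thesis .
qed

lemma tridiagonal_mat_eq_0:
  assumes "tridiagonal_mat M" "i < dim_row M" "j < dim_col M" "i \<noteq> j" "i \<noteq> Suc j" "j \<noteq> Suc i"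
  shows "M $$ (i, j) = 0"
  using assms unfolding tridiagonal_mat_def by metis

context vector_space
begin

lemma indexed_basis_subspace: "indexed_basis scale V v \<Longrightarrow> subspace V"
  unfolding indexed_basis_def using subspace_span by metis

lemma indexed_basis_mem: "indexed_basis scale V v \<Longrightarrow> i \<le> diameter scale V \<Longrightarrow> v i \<in> V"
  unfolding indexed_basis_def using span_base by (metis atMost_iff image_eqI)

lemma coord_add:
  assumes "indexed_basis scale V v" "x \<in> V" "y \<in> V"
  shows "coord scale V v (x + y) i = coord scale V v x i + coord scale V v y i"
  using assms unfolding indexed_basis_def coord_def by (simp add: representation_add)

lemma coord_scale:
  assumes "indexed_basis scale V v" "x \<in> V"
  shows "coord scale V v (scale c x) i = c * coord scale V v x i"
  using assms unfolding indexed_basis_def coord_def by (simp add: representation_scale)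

lemma coord_basis:
  assumes "indexed_basis scale V v" "i \<le> diameter scale V" "j \<le> diameter scale V"
  shows "coord scale V v (v j) i = (if i = j then 1 else 0)"
  using assms unfolding indexed_basis_def coord_def
  by (auto simp: representation_basis inj_on_def)

lemma coord_zero: "coord scale V v 0 i = 0"
  by (simp add: coord_def representation_zero)

lemma coord_expand:
  assumes "indexed_basis scale V v" "x \<in> V"
  shows "(\<Sum>i\<le>diameter scale V. scale (coord scale V v x i) (v i)) = x"
proof -
  let ?B = "v ` {..diameter scale V}"
  have "(\<Sum>b\<in>?B. scale (representation ?B x b) b) = x"
    using assms by (intro sum_representation_eq) (auto simp: indexed_basis_def)
  then show ?thesis
    using assms by (simp add: sum.reindex indexed_basis_def coord_def)
qed

lemma coord_sum:
  assumes "indexed_basis scale V v" "\<And>i. i \<in> I \<Longrightarrow> f i \<in> V"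
  shows "coord scale V v (\<Sum>i\<in>I. f i) k = (\<Sum>i\<in>I. coord scale V v (f i) k)"
  using assms unfolding indexed_basis_def coord_def by (simp add: representation_sum)

lemma coord_combination:
  assumes "indexed_basis scale V v" "k \<le> diameter scale V"
  shows "coord scale V v (\<Sum>i\<le>diameter scale V. scale (a i) (v i)) k = a k"
proof -
  have "coord scale V v (\<Sum>i\<le>diameter scale V. scale (a i) (v i)) k
      = (\<Sum>i\<le>diameter scale V. coord scale V v (scale (a i) (v i)) k)"
    using assms(1)
    by (intro coord_sum)
      (auto intro: subspace_scale indexed_basis_mem[OF assms(1)] indexed_basis_subspace[OF assms(1)])
  also have "\<dots> = (\<Sum>i\<le>diameter scale V. a i * (if k = i then 1 else 0))"
    using assms by (intro sum.cong) (auto simp: coord_scale indexed_basis_mem coord_basis)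
  also have "\<dots> = a k"
    using assms by (subst sum_up_to_single[of k]) auto
  finally show ?thesis .
qed

lemma linear_map_on_sum:
  assumes "subspace V" "linear_map_on scale s2 V W f" "vector_space s2" "\<And>i. i \<in> I \<Longrightarrow> x i \<in> V"
  shows "f (\<Sum>i\<in>I. scale (a i) (x i)) = (\<Sum>i\<in>I. s2 (a i) (f (x i)))"
proof -
  interpret W: vector_space s2 by fact
  have "f 0 = 0"
    using linear_map_onD(3)[OF assms(2) subspace_0[OF assms(1)], of 0] by simp
  then show ?thesis
    using assms(4)
  proof (induction I rule: infinite_finite_induct)
    case (insert i I)
    have "(\<Sum>i\<in>I. scale (a i) (x i)) \<in> V" "scale (a i) (x i) \<in> V"
      using insert assms(1) by (auto intro!: subspace_sum subspace_scale)
    with insert show ?case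
      by (simp add: linear_map_onD(2)[OF assms(2)] linear_map_onD(3)[OF assms(2)])
  qed auto
qed

section \<open>Criteria for a family of vectors to be a basis\<close>

text \<open>A dimension count: \<open>v\<close> spans \<open>V\<close> with as many vectors as
  \<open>w\<close> has, so independence of \<open>w\<close> already forces it to span.\<close>

lemma indexed_basis_eqI:
  assumes v: "indexed_basis scale V v"
    and w: "\<And>i. i \<le> diameter scale V \<Longrightarrow> w i \<in> V"
    and indep: "\<And>a i. (\<Sum>i\<le>diameter scale V. scale (a i) (w i)) = 0 \<Longrightarrow> i \<le> diameter scale V
      \<Longrightarrow> a i = 0"
  shows "indexed_basis scale V w"
proof -
  let ?d = "diameter scale V" and ?B = "w ` {..diameter scale V}"
  have inj: "inj_on w {..?d}"
  proof (rule inj_onI, rule ccontr)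
    fix i j assume ij: "i \<in> {..?d}" "j \<in> {..?d}" "w i = w j" "i \<noteq> j"
    \<comment> \<open>A repeated vector would give the nontrivial relation
      \<open>w i - w j = 0\<close>.\<close>
    let ?a = "\<lambda>k. if k = i then 1 else if k = j then - 1 else 0"
    have "(\<Sum>k\<le>?d. scale (?a k) (w k)) = (\<Sum>k\<in>{i, j}. scale (?a k) (w k))"
      using ij by (intro sum.mono_neutral_right) auto
    also have "\<dots> = 0" using ij by simp
    finally show False using indep[of ?a i] ij by simp
  qed
  have ind: "independent ?B"
  proof (rule independent_if_scalars_zero)
    fix f x assume "(\<Sum>x\<in>?B. scale (f x) x) = 0" "x \<in> ?B"
    then show "f x = 0"
      using indep[of "\<lambda>i. f (w i)"] inj by (auto simp: sum.reindex)
  qed simp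
  have "span ?B = V"
  proof
    show "span ?B \<subseteq> V"
      using w indexed_basis_subspace[OF v] by (intro span_minimal) auto
    show "V \<subseteq> span ?B"
    proof (rule ccontr)
      assume "\<not> V \<subseteq> span ?B"
      then obtain x where x: "x \<in> V" "x \<notin> span ?B" by blast
      \<comment> \<open>A vector of \<open>V\<close> outside the span of \<open>w\<close> would
        enlarge \<open>w\<close> to an independent family with more members than the spanning family
        \<open>v\<close>.\<close>
      have "insert x ?B \<subseteq> span (v ` {..?d})"
        using v w x by (auto simp: indexed_basis_def)
      then have "card (insert x ?B) \<le> card (v ` {..?d})"
        using x ind independent_span_bound[of "v ` {..?d}" "insert x ?B"]
        by (simp add: independent_insertI)
      moreover have "x \<notin> ?B" using x(2) span_base[of x ?B] by (rule contrapos_nn)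
      ultimately show False
        using v inj by (simp add: indexed_basis_def card_image)
    qed
  qed
  with inj ind show ?thesis by (simp add: indexed_basis_def)
qed

lemma indexed_basis_rescale:
  assumes "indexed_basis scale V v" "\<And>i. i \<le> diameter scale V \<Longrightarrow> l i \<noteq> 0"
  shows "indexed_basis scale V (\<lambda>i. scale (l i) (v i))"
proof (rule indexed_basis_eqI[OF assms(1)])
  fix a i assume a: "(\<Sum>i\<le>diameter scale V. scale (a i) (scale (l i) (v i))) = 0"
    and i: "i \<le> diameter scale V"
  have "a i * l i = 0"
    using coord_combination[OF assms(1) i, of "\<lambda>i. a i * l i"] a by (simp add: coord_zero)
  then show "a i = 0" using assms(2) i by simp
qed (auto intro: subspace_scale indexed_basis_mem[OF assms(1)] indexed_basis_subspace[OF assms(1)])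

lemma indexed_basis_reverse:
  assumes "indexed_basis scale V v"
  shows "indexed_basis scale V (\<lambda>i. v (diameter scale V - i))"
proof -
  let ?d = "diameter scale V"
  have "(\<lambda>i. v (?d - i)) ` {..?d} = v ` {..?d}"
  proof (intro equalityI subsetI)
    fix x assume "x \<in> v ` {..?d}"
    then obtain i where "i \<le> ?d" "x = v i" by blast
    then show "x \<in> (\<lambda>i. v (?d - i)) ` {..?d}"
      by (intro image_eqI[of _ _ "?d - i"]) auto
  qed auto
  moreover have "inj_on (\<lambda>i. v (?d - i)) {..?d}"
  proof (rule inj_onI)
    fix i j assume "i \<in> {..?d}" "j \<in> {..?d}" "v (?d - i) = v (?d - j)"
    then have "?d - i = ?d - j"
      using assms inj_onD[of v "{..?d}" "?d - i" "?d - j"] by (simp add: indexed_basis_def)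
    then show "i = j" using \<open>i \<in> {..?d}\<close> \<open>j \<in> {..?d}\<close> by auto
  qed
  ultimately show ?thesis using assms by (simp add: indexed_basis_def)
qed

text \<open>Eigenvectors for distinct eigenvalues are independent, and there are as many of them as
  the dimension.\<close>

lemma eigenvectors_indexed_basis:
  assumes v: "indexed_basis scale V v" and lin: "linear_map_on scale scale V V f"
    and wV: "\<And>i. i \<le> diameter scale V \<Longrightarrow> w i \<in> V"
    and w0: "\<And>i. i \<le> diameter scale V \<Longrightarrow> w i \<noteq> 0"
    and eig: "\<And>i. i \<le> diameter scale V \<Longrightarrow> f (w i) = scale (\<theta> i) (w i)"
    and inj: "inj_on \<theta> {..diameter scale V}"
  shows "indexed_basis scale V w"
proof (rule indexed_basis_eqI[OF v])
  let ?d = "diameter scale V"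
  have sub: "subspace V" using v by (rule indexed_basis_subspace)
  have indep: "a i = 0" if "I \<subseteq> {..?d}" "(\<Sum>i\<in>I. scale (a i) (w i)) = 0" "i \<in> I" for a i I
  proof -
    have "finite I" using that finite_subset by blast
    then show ?thesis using that
    proof (induction I arbitrary: a i)
      case (insert j I)
      have le: "k \<le> ?d" if "k \<in> insert j I" for k
        using insert.prems(1) that by auto
      have "f 0 = 0"
        using linear_map_onD(3)[OF lin subspace_0[OF sub], of 0] by simp
      then have "0 = f (\<Sum>i\<in>insert j I. scale (a i) (w i))"
        unfolding insert.prems(2) by (rule sym)
      also have "\<dots> = (\<Sum>i\<in>insert j I. scale (a i) (f (w i)))"
        by (intro linear_map_on_sum[OF sub lin] wV[OF le] vector_space_axioms)
      also have "\<dots> = (\<Sum>i\<in>insert j I. scale (a i * \<theta> i) (w i))"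
        by (intro sum.cong refl) (simp only: eig[OF le] scale_scale)
      finally have "(\<Sum>i\<in>insert j I. scale (a i * \<theta> i) (w i)) = 0" ..
      \<comment> \<open>Subtracting \<open>\<theta> j\<close> times the original relation removes
        the term at \<open>j\<close> and leaves a relation over \<open>I\<close> alone.\<close>
      then have "(\<Sum>i\<in>insert j I. scale (a i * \<theta> i) (w i))
          - scale (\<theta> j) (\<Sum>i\<in>insert j I. scale (a i) (w i)) = 0"
        by (simp only: insert.prems(2) scale_zero_right diff_zero)
      also have "(\<Sum>i\<in>insert j I. scale (a i * \<theta> i) (w i))
          - scale (\<theta> j) (\<Sum>i\<in>insert j I. scale (a i) (w i))
          = (\<Sum>i\<in>insert j I. scale (a i * (\<theta> i - \<theta> j)) (w i))"
        unfolding scale_sum_right sum_subtractf[symmetric]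
        by (intro sum.cong refl) (simp add: algebra_simps scale_left_diff_distrib)
      finally have "(\<Sum>i\<in>insert j I. scale (a i * (\<theta> i - \<theta> j)) (w i)) = 0" .
      then have "(\<Sum>i\<in>I. scale (a i * (\<theta> i - \<theta> j)) (w i)) = 0"
        using insert.hyps by simp
      then have "a k * (\<theta> k - \<theta> j) = 0" if "k \<in> I" for k
        using insert.IH[of "\<lambda>i. a i * (\<theta> i - \<theta> j)" k] insert.prems(1) that by blast
      moreover have "\<theta> k \<noteq> \<theta> j" if "k \<in> I" for k
        using inj insert.prems insert.hyps that by (auto simp: inj_on_def)
      ultimately have aI: "a k = 0" if "k \<in> I" for k using that by auto
      then have "scale (a j) (w j) = 0" using insert.prems(2) insert.hyps by simp
      moreover have "w j \<noteq> 0" using w0[OF le] by blast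
      ultimately have "a j = 0" by simp
      with aI insert.prems(3) show ?case by auto
    qed simp
  qed
  show "a i = 0" if "(\<Sum>i\<le>?d. scale (a i) (w i)) = 0" "i \<le> ?d" for a i
    using indep[of "{..?d}" a i] that by simp
qed (rule wV)

end

section \<open>The scalar recurrences\<close>

text \<open>Here \<open>x i\<close> stands for the product of the two off-diagonal entries that
  couple positions \<open>i - 1\<close> and \<open>i\<close>. Once the sums of neighbouring
  eigenvalues are known to be \<open>r\<close> with alternating sign, \<open>rec\<close> becomes a
  first difference, its solution is quadratic in \<open>i\<close>, and the zero at
  \<open>Suc d\<close> fixes \<open>\<theta> 0\<close>.\<close>

lemma scalar_recurrences:
  fixes \<theta> x :: "nat \<Rightarrow> 'k::field_char_0"
  assumes d: "2 \<le> d" and inj: "inj_on \<theta> {..d}"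
    and sq: "\<And>i. i < d \<Longrightarrow> (\<theta> i + \<theta> (Suc i))\<^sup>2 = \<rho>"
    and x0: "x 0 = 0" and xd: "x (Suc d) = 0" and x1: "x 1 \<noteq> 0"
    and rec: "\<And>i. i \<le> d \<Longrightarrow>
      2 * (\<theta> i + \<theta> (Suc i)) * x (Suc i) + 2 * (\<theta> i + \<theta> (i - 1)) * x i = \<rho>s * \<theta> i"
  obtains \<alpha> where "even d" "\<rho> = 4 * \<alpha>\<^sup>2" "\<alpha> \<noteq> 0" "\<rho>s \<noteq> 0"
    "\<And>i. i \<le> d \<Longrightarrow> \<theta> i = \<alpha> * (- 1) ^ i * (of_nat d - 2 * of_nat i)"
    "\<And>i. i \<le> d \<Longrightarrow> 4 * x i = \<rho>s * of_nat i * (of_nat d + 1 - of_nat i)"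
proof -
  define r where "r = \<theta> 0 + \<theta> 1"
  have sgn: "\<theta> i + \<theta> (Suc i) = (- 1) ^ i * r" if "i < d" for i
    using that
  proof (induction i)
    case 0
    then show ?case by (simp add: r_def)
  next
    case (Suc i)
    have "(\<theta> i + \<theta> (Suc i))\<^sup>2 = (\<theta> (Suc i) + \<theta> (Suc (Suc i)))\<^sup>2"
      using sq Suc.prems by simp
    moreover have "\<theta> i \<noteq> \<theta> (Suc (Suc i))"
      using inj_onD[OF inj, of i "Suc (Suc i)"] Suc.prems by auto
    \<comment> \<open>The squares leave two signs, and equal sums would give
      \<open>\<theta> i = \<theta> (Suc (Suc i))\<close>.\<close>
    ultimately have "\<theta> i + \<theta> (Suc i) = - (\<theta> (Suc i) + \<theta> (Suc (Suc i)))"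
      unfolding power2_eq_iff by (metis add.commute add_left_imp_eq)
    then have "\<theta> (Suc i) + \<theta> (Suc (Suc i)) = - (\<theta> i + \<theta> (Suc i))"
      by (simp only: minus_minus)
    with Suc show ?case by simp
  qed
  have r0: "r \<noteq> 0"
  proof
    assume "r = 0"
    then have "\<theta> 0 = \<theta> 2"
      using sgn[of 0] sgn[of 1] d by (simp add: numeral_2_eq_2 add_eq_0_iff2)
    then show False using inj_onD[OF inj, of 0 2] d by simp
  qed
  have th: "\<theta> i = (- 1) ^ i * (\<theta> 0 - of_nat i * r)" if "i \<le> d" for i
    using that
  proof (induction i)
    case (Suc i)
    have "\<theta> (Suc i) = (- 1) ^ i * r - \<theta> i"
      using sgn[of i] Suc.prems by (simp add: algebra_simps eq_diff_eq)
    also have "\<dots> = (- 1) ^ Suc i * (\<theta> 0 - of_nat (Suc i) * r)"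
      using Suc by (simp add: algebra_simps)
    finally show ?case .
  qed simp
  have step: "2 * r * (x (Suc i) - x i) = \<rho>s * (\<theta> 0 - of_nat i * r)" if "i \<le> d" for i
  proof -
    have e: "(- 1) ^ i * ((- 1) ^ i * y) = y" for y :: 'k
      by (simp flip: mult.assoc power_mult_distrib)
    \<comment> \<open>At \<open>i = d\<close> the value \<open>\<theta> (Suc d)\<close> is
      unconstrained, but \<open>x (Suc d) = 0\<close> removes it. In the next equation
      \<open>x 0 = 0\<close> covers \<open>i = 0\<close>, where \<open>i - 1\<close> is
      \<open>0\<close> as well.\<close>
    have 1: "(\<theta> i + \<theta> (Suc i)) * x (Suc i) = (- 1) ^ i * (r * x (Suc i))"
      using sgn[of i] that xd by (cases "i = d") auto
    have 2: "(\<theta> i + \<theta> (i - 1)) * x i = - ((- 1) ^ i * (r * x i))"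
      using sgn[of "i - 1"] that x0 by (cases i) (auto simp: algebra_simps)
    have "(- 1) ^ i * (2 * r * (x (Suc i) - x i)) = \<rho>s * \<theta> i"
    proof -
      have "\<rho>s * \<theta> i = 2 * ((\<theta> i + \<theta> (Suc i)) * x (Suc i)) + 2 * ((\<theta> i + \<theta> (i - 1)) * x i)"
        using rec[OF that] by (simp only: mult.assoc)
      then show ?thesis unfolding 1 2 by (simp add: algebra_simps)
    qed
    also have "\<dots> = (- 1) ^ i * (\<rho>s * (\<theta> 0 - of_nat i * r))"
      using th[OF that] by simp
    finally have "(- 1) ^ i * ((- 1) ^ i * (2 * r * (x (Suc i) - x i)))
        = (- 1) ^ i * ((- 1) ^ i * (\<rho>s * (\<theta> 0 - of_nat i * r)))" by simp
    then show ?thesis unfolding e .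
  qed
  \<comment> \<open>Summing \<open>step\<close> from \<open>0\<close> amounts to summing an
    arithmetic progression.\<close>
  have xs: "4 * r * x i = \<rho>s * of_nat i * (2 * \<theta> 0 - (of_nat i - 1) * r)" if "i \<le> Suc d" for i
    using that
  proof (induction i)
    case 0
    then show ?case using x0 by simp
  next
    case (Suc i)
    have "4 * r * x (Suc i) = 4 * r * x i + 2 * (2 * r * (x (Suc i) - x i))"
      by (simp add: algebra_simps)
    also have "\<dots> = \<rho>s * of_nat (Suc i) * (2 * \<theta> 0 - (of_nat (Suc i) - 1) * r)"
      unfolding step[of i, OF Suc.prems[unfolded Suc_le_mono]] Suc.IH[OF Suc_leD[OF Suc.prems]]
      by (simp add: algebra_simps)
    finally show ?case .
  qed
  have rs0: "\<rho>s \<noteq> 0" using xs[of 1] x1 r0 d by auto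
  \<comment> \<open>The closed form vanishes at \<open>Suc d\<close>. Its factors
    \<open>\<rho>s\<close> and \<open>d + 1\<close> do not, so the linear factor does, which gives
    \<open>\<theta> 0\<close>.\<close>
  have "of_nat (Suc d) \<noteq> (0 :: 'k)" by (simp del: of_nat_Suc)
  then have th0: "2 * \<theta> 0 = of_nat d * r"
    using xs[of "Suc d"] xd rs0 by (simp del: of_nat_Suc) simp
  define \<alpha> where "\<alpha> = r / 2"
  have r: "r = 2 * \<alpha>" "\<theta> 0 = of_nat d * \<alpha>" using th0 by (auto simp: \<alpha>_def field_simps)
  have th': "\<theta> i = \<alpha> * (- 1) ^ i * (of_nat d - 2 * of_nat i)" if "i \<le> d" for i
    using th[OF that] by (simp add: r algebra_simps)
  have "even d"
  proof (rule ccontr)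
    assume "odd d"
    then have "\<theta> d = \<theta> 0" using th'[of d] by (simp add: r)
    then show False using inj_onD[OF inj, of d 0] d by simp
  qed
  moreover have "\<rho> = r\<^sup>2" using sq[of 0] d by (simp add: r_def)
  then have "\<rho> = 4 * \<alpha>\<^sup>2" by (simp add: r(1) power_mult_distrib)
  moreover have a0: "\<alpha> \<noteq> 0" using r0 r by simp
  moreover have "4 * x i = \<rho>s * of_nat i * (of_nat d + 1 - of_nat i)" if "i \<le> d" for i
  proof -
    have "2 * \<alpha> * (4 * x i) = 2 * \<alpha> * (\<rho>s * of_nat i * (of_nat d + 1 - of_nat i))"
      using xs[of i] that by (simp add: r algebra_simps)
    then show ?thesis using a0 by simp
  qed
  ultimately show thesis using that rs0 th' by blast
qed

section \<open>The normal form\<close>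

text \<open>In this basis \<open>As\<close> is \<beta> times the Sylvester-Kac (Clement) matrix. At
  both ends the coefficient of the out-of-range neighbour is zero, so the formula needs no boundary
  cases.\<close>

definition krawtchouk_basis ::
  "('k::field \<Rightarrow> 'v::ab_group_add \<Rightarrow> 'v) \<Rightarrow> 'v set \<Rightarrow> 'k \<Rightarrow> 'k \<Rightarrow> ('v \<Rightarrow> 'v) \<Rightarrow> ('v \<Rightarrow> 'v) \<Rightarrow>
   (nat \<Rightarrow> 'v) \<Rightarrow> bool" where
  "krawtchouk_basis scale V \<alpha> \<beta> A As w \<longleftrightarrow> indexed_basis scale V w \<and>
     (\<forall>i\<le>diameter scale V.
        A (w i) = scale (\<alpha> * (- 1) ^ i * (of_nat (diameter scale V) - 2 * of_nat i)) (w i) \<and>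
        As (w i) = scale (\<beta> * (of_nat (diameter scale V) - of_nat i)) (w (Suc i))
          + scale (\<beta> * of_nat i) (w (i - 1)))"

section \<open>Tridiagonal action and simple eigenvalues\<close>

context vector_space
begin

lemma matrix_wrt_dim [simp]:
  "dim_row (matrix_wrt scale V v A) = Suc (diameter scale V)"
  "dim_col (matrix_wrt scale V v A) = Suc (diameter scale V)"
  by (simp_all add: matrix_wrt_def)

lemma matrix_wrt_entry:
  "i \<le> diameter scale V \<Longrightarrow> j \<le> diameter scale V \<Longrightarrow>
    matrix_wrt scale V v A $$ (i, j) = coord scale V v (A (v j)) i"
  by (simp add: matrix_wrt_def coord_def)

lemma standard_basis_eigenvector:
  assumes "standard_basis scale V A As v" "linear_map_on scale scale V V A" "j \<le> diameter scale V"
  shows "A (v j) = scale (coord scale V v (A (v j)) j) (v j)"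
proof -
  have v: "indexed_basis scale V v" using assms by (simp add: standard_basis_def)
  have "coord scale V v (A (v j)) i = 0" if "i \<le> diameter scale V" "i \<noteq> j" for i
    using assms that matrix_wrt_entry[of i V j v A]
    by (auto simp: standard_basis_def diagonal_mat_def)
  then have "(\<Sum>i\<le>diameter scale V. scale (coord scale V v (A (v j)) i) (v i))
      = scale (coord scale V v (A (v j)) j) (v j)"
    using assms(3) by (intro sum_up_to_single) auto
  then show ?thesis
    using coord_expand[OF v linear_map_onD(1)[OF assms(2) indexed_basis_mem[OF v assms(3)]]] by simp
qed

text \<open>The columns of the bipartite matrix are read as an action on basis vectors. The zeros
  \<open>b (diameter scale V)\<close> and \<open>c 0\<close> neutralise the arbitrary vector past
  the end and the truncated \<open>0 - 1\<close>.\<close>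

lemma bipartite_standard_basisE:
  assumes "standard_basis scale V A As v" "bipartite_mat (matrix_wrt scale V v As)"
    and lin: "linear_map_on scale scale V V As"
  obtains b c where "\<And>j. j < diameter scale V \<Longrightarrow> b j \<noteq> 0" "b (diameter scale V) = 0"
    "\<And>j. 0 < j \<Longrightarrow> j \<le> diameter scale V \<Longrightarrow> c j \<noteq> 0" "c 0 = 0"
    "\<And>j. j \<le> diameter scale V \<Longrightarrow> As (v j) = scale (b j) (v (Suc j)) + scale (c j) (v (j - 1))"
proof -
  let ?d = "diameter scale V" and ?M = "matrix_wrt scale V v As"
  have v: "indexed_basis scale V v" and irr: "irreducible_tridiagonal_mat ?M"
    using assms by (auto simp: standard_basis_def)
  define b where "b j = (if j < ?d then ?M $$ (Suc j, j) else 0)" for j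
  define c where "c j = (if 0 < j then ?M $$ (j - 1, j) else 0)" for j
  show thesis
  proof (rule that)
    show "b j \<noteq> 0" if "j < ?d" for j
      using irr that by (simp add: b_def irreducible_tridiagonal_mat_def)
    show "c j \<noteq> 0" if "0 < j" "j \<le> ?d" for j
      using irr that by (cases j) (auto simp: c_def irreducible_tridiagonal_mat_def)
    show "As (v j) = scale (b j) (v (Suc j)) + scale (c j) (v (j - 1))" if j: "j \<le> ?d" for j
    proof -
      have zero: "?M $$ (i, j) = 0" if "i \<le> ?d" "i \<noteq> Suc j" "j \<noteq> Suc i" for i
        using assms(2) that j by (cases "i = j") (auto simp: bipartite_mat_def tridiagonal_mat_eq_0)
      have "As (v j) = (\<Sum>i\<le>?d. scale (coord scale V v (As (v j)) i) (v i))"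
        using coord_expand[OF v linear_map_onD(1)[OF lin indexed_basis_mem[OF v j]]] by simp
      also have "\<dots> = (\<Sum>i\<le>?d. scale (?M $$ (i, j)) (v i))"
        using j by (intro sum.cong refl) (simp add: matrix_wrt_entry)
      also have "\<dots> = (if j < ?d then scale (?M $$ (Suc j, j)) (v (Suc j)) else 0)
          + (if 0 < j then scale (?M $$ (j - 1, j)) (v (j - 1)) else 0)"
        using j zero by (intro sum_up_to_Suc_pred) auto
      finally show ?thesis by (simp add: b_def c_def)
    qed
  qed (simp_all add: b_def c_def)
qed

text \<open>Since the superdiagonal entries are nonzero, row \<open>j\<close> of the eigenvalue
  equation determines coordinate \<open>j + 1\<close> from the earlier ones. An eigenvector is thus
  determined by its first coordinate.\<close>

lemma eigenvector_eq_0: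
  assumes sb: "standard_basis scale V As A v" and lin: "linear_map_on scale scale V V A"
    and u: "u \<in> V" "A u = scale \<theta> u" "coord scale V v u 0 = 0"
  shows "u = 0"
proof -
  let ?d = "diameter scale V" and ?M = "matrix_wrt scale V v A" and ?y = "coord scale V v u"
  have v: "indexed_basis scale V v" and irr: "irreducible_tridiagonal_mat ?M"
    using sb by (auto simp: standard_basis_def)
  note sub = indexed_basis_subspace[OF v]
  have row: "\<theta> * ?y k = (\<Sum>l\<le>?d. ?M $$ (k, l) * ?y l)" if k: "k \<le> ?d" for k
  proof -
    have AV: "A (v l) \<in> V" if "l \<le> ?d" for l
      by (rule linear_map_onD(1)[OF lin indexed_basis_mem[OF v that]])
    have "A u = A (\<Sum>l\<le>?d. scale (?y l) (v l))"
      using coord_expand[OF v u(1)] by simp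
    also have "\<dots> = (\<Sum>l\<le>?d. scale (?y l) (A (v l)))"
      by (rule linear_map_on_sum[OF sub lin vector_space_axioms]) (simp add: indexed_basis_mem[OF v])
    finally have "coord scale V v (scale \<theta> u) k
        = (\<Sum>l\<le>?d. coord scale V v (scale (?y l) (A (v l))) k)"
      unfolding u(2) using coord_sum[OF v, of "{..?d}" "\<lambda>l. scale (?y l) (A (v l))" k] AV
      by (simp add: subspace_scale[OF sub])
    also have "\<dots> = (\<Sum>l\<le>?d. ?M $$ (k, l) * ?y l)"
      by (intro sum.cong refl) (simp add: coord_scale[OF v] AV matrix_wrt_entry k mult.commute)
    finally show ?thesis by (simp add: coord_scale[OF v] u(1))
  qed
  have "?y k = 0" if "k \<le> ?d" for k
    using that
  proof (induction k rule: less_induct)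
    case (less k)
    show ?case
    proof (cases k)
      case 0
      then show ?thesis using u(3) by simp
    next
      case (Suc j)
      \<comment> \<open>Coordinates up to \<open>j\<close> vanish by induction, and entries beyond
        \<open>Suc j\<close> by tridiagonality.\<close>
      have "(\<Sum>l\<le>?d. ?M $$ (j, l) * ?y l) = ?M $$ (j, Suc j) * ?y (Suc j)"
      proof (rule sum_up_to_single)
        fix l assume l: "l \<le> ?d" "l \<noteq> Suc j"
        show "?M $$ (j, l) * ?y l = 0"
        proof (cases "l \<le> j")
          case True
          then show ?thesis using less Suc by simp
        next
          case False
          then have "?M $$ (j, l) = 0"
            using irr l less.prems Suc
            by (intro tridiagonal_mat_eq_0) (auto simp: irreducible_tridiagonal_mat_def)
          then show ?thesis by simp
        qed
      qed (use less Suc in simp)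
      moreover have "?y j = 0" using less Suc by simp
      moreover have "?M $$ (j, Suc j) \<noteq> 0"
        using irr less.prems Suc by (simp add: irreducible_tridiagonal_mat_def)
      ultimately show ?thesis using row[of j] less.prems Suc by simp
    qed
  qed
  then have "(\<Sum>i\<le>?d. scale (?y i) (v i)) = 0" by simp
  then show ?thesis using coord_expand[OF v u(1)] by simp
qed

text \<open>As \<open>A\<close> is irreducible tridiagonal in the other basis, its eigenspaces are
  at most one-dimensional, while two basis vectors with a common eigenvalue would span a
  plane.\<close>

lemma standard_basis_distinct_eigenvalues:
  assumes sb: "standard_basis scale V A As v" and sbs: "standard_basis scale V As A vs"
    and lin: "linear_map_on scale scale V V A"
    and eig: "\<And>i. i \<le> diameter scale V \<Longrightarrow> A (v i) = scale (\<theta> i) (v i)"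
  shows "inj_on \<theta> {..diameter scale V}"
proof (rule inj_onI, rule ccontr)
  let ?d = "diameter scale V"
  fix i j assume "i \<in> {..?d}" "j \<in> {..?d}" and th: "\<theta> i = \<theta> j" and ij: "i \<noteq> j"
  then have le: "i \<le> ?d" "j \<le> ?d" by auto
  have v: "indexed_basis scale V v" and vs: "indexed_basis scale V vs"
    using sb sbs by (auto simp: standard_basis_def)
  note sub = indexed_basis_subspace[OF v]
  note mem = indexed_basis_mem[OF v le(1)] indexed_basis_mem[OF v le(2)]
  \<comment> \<open>The coefficients are chosen to cancel the first coordinates with respect to
    \<open>vs\<close>.\<close>
  define a where "a = coord scale V vs (v j) 0"
  define b where "b = - coord scale V vs (v i) 0"
  have V: "scale a (v i) \<in> V" "scale b (v j) \<in> V"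
    using mem by (auto intro: subspace_scale[OF sub])
  have "scale a (v i) + scale b (v j) = 0"
  proof (rule eigenvector_eq_0[OF sbs lin])
    show "scale a (v i) + scale b (v j) \<in> V" using V by (rule subspace_add[OF sub])
    show "A (scale a (v i) + scale b (v j)) = scale (\<theta> i) (scale a (v i) + scale b (v j))"
      using V mem le th
      by (simp add: linear_map_onD[OF lin] eig scale_right_distrib mult.commute)
    show "coord scale V vs (scale a (v i) + scale b (v j)) 0 = 0"
      unfolding coord_add[OF vs V] coord_scale[OF vs mem(1)] coord_scale[OF vs mem(2)]
      by (simp add: a_def b_def)
  qed
  then have "coord scale V v (scale a (v i) + scale b (v j)) i = 0" by (simp add: coord_zero)
  then have "coord scale V vs (v j) 0 = 0"
    using V mem le ij by (simp add: coord_add[OF v] coord_scale[OF v] coord_basis[OF v] a_def)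
  then have "v j = 0"
    using eigenvector_eq_0[OF sbs lin mem(2) eig[OF le(2)]] by simp
  then show False using coord_basis[OF v le(2) le(2)] by (simp add: coord_zero)
qed

end

section \<open>Reduction of a Leonard pair to the normal form\<close>

text \<open>Coordinates of the cubic relations at basis vectors supply the hypotheses of
  \<open>scalar_recurrences\<close>. The root \<beta> is prescribed, whereas \<alpha> is read off
  from the eigenvalues, so its sign depends on the order of the basis.\<close>

lemma krawtchouk_basis_exists:
  fixes scale :: "'k::field_char_0 \<Rightarrow> 'v::ab_group_add \<Rightarrow> 'v"
  assumes lp: "leonard_pair scale V A As" and tb: "totally_bipartite scale V A As"
    and cr: "cubic_relations scale \<rho> (4 * \<beta>\<^sup>2) V A As"
    and d: "2 \<le> diameter scale V"
  obtains \<alpha> w where "even (diameter scale V)" "\<rho> = 4 * \<alpha>\<^sup>2" "\<alpha> \<noteq> 0" "\<beta> \<noteq> 0"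
    "krawtchouk_basis scale V \<alpha> \<beta> A As w"
proof -
  interpret vector_space scale using lp by (simp add: leonard_pair_def)
  let ?d = "diameter scale V"
  have linA: "linear_map_on scale scale V V A" and linAs: "linear_map_on scale scale V V As"
    using lp by (auto simp: leonard_pair_def)
  obtain v vs where sb: "standard_basis scale V A As v" "bipartite_mat (matrix_wrt scale V v As)"
    and sbs: "standard_basis scale V As A vs"
    using tb by (auto simp: totally_bipartite_def)
  have v: "indexed_basis scale V v" using sb by (simp add: standard_basis_def)
  note sub = indexed_basis_subspace[OF v]
  define \<theta> where "\<theta> i = coord scale V v (A (v i)) i" for i
  have eig: "A (v i) = scale (\<theta> i) (v i)" if "i \<le> ?d" for i
    unfolding \<theta>_def by (rule standard_basis_eigenvector[OF sb(1) linA that])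
  have inj: "inj_on \<theta> {..?d}"
    by (rule standard_basis_distinct_eigenvalues[OF sb(1) sbs linA eig])
  obtain b0 c0 where b0: "\<And>j. j < ?d \<Longrightarrow> b0 j \<noteq> 0" "b0 ?d = 0"
    and c0: "\<And>j. 0 < j \<Longrightarrow> j \<le> ?d \<Longrightarrow> c0 j \<noteq> 0" "c0 0 = 0"
    and act: "\<And>j. j \<le> ?d \<Longrightarrow> As (v j) = scale (b0 j) (v (Suc j)) + scale (c0 j) (v (j - 1))"
    by (rule bipartite_standard_basisE[OF sb linAs]) (rule that)
  \<comment> \<open>Extension by zero beyond the diameter makes the action formulas valid for every
    index.\<close>
  define b c e where "b j = (if j < ?d then b0 j else 0)"
    and "c j = (if j \<le> ?d then c0 j else 0)" and "e j = (if j \<le> ?d then v j else 0)" for j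
  have eV: "e j \<in> V" for j
    using indexed_basis_mem[OF v] subspace_0[OF sub] by (simp add: e_def)
  have zero: "A 0 = 0" "As 0 = 0"
    using linear_map_onD(3)[OF linA subspace_0[OF sub], of 0]
      linear_map_onD(3)[OF linAs subspace_0[OF sub], of 0] by simp_all
  have Ae: "A (e j) = scale (\<theta> j) (e j)" for j
    by (simp add: e_def eig zero)
  have Ase: "As (e j) = scale (b j) (e (Suc j)) + scale (c j) (e (j - 1))" for j
    using act[of j] b0(2) by (cases "j = ?d") (auto simp: e_def b_def c_def zero)
  have coord_e: "coord scale V v (e j) k = (if k = j then 1 else 0)" if "k \<le> ?d" for j k
    using that coord_basis[OF v that, of j] by (auto simp: e_def coord_zero)
  note mem = eV subspace_add[OF sub] subspace_scale[OF sub]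
    linear_map_onD(1)[OF linA] linear_map_onD(1)[OF linAs]
  note expand = linear_map_onD(2,3)[OF linA] linear_map_onD(2,3)[OF linAs] Ae Ase
  note coords = coord_add[OF v] coord_scale[OF v] coord_e
  have ne: "Suc i \<noteq> i - Suc 0" for i by linarith
  have c00: "c 0 = 0" using c0(2) by (simp add: c_def)
  have sq: "(\<theta> i + \<theta> (Suc i))\<^sup>2 = \<rho>" if "i < ?d" for i
  proof -
    have rel: "A (A (As (e i))) + scale 2 (A (As (A (e i)))) + As (A (A (e i))) = scale \<rho> (As (e i))"
      using cr eV by (simp add: cubic_relations_def)
    \<comment> \<open>The component of the first relation at the upper neighbour isolates the
      square, up to the nonzero factor \<open>b i\<close>.\<close>
    from arg_cong[OF rel, of "\<lambda>x. coord scale V v x (Suc i)"]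
    have "b i * \<theta> (Suc i) * \<theta> (Suc i) + 2 * (b i * \<theta> i * \<theta> (Suc i)) + b i * \<theta> i * \<theta> i = \<rho> * b i"
      using that ne by (simp add: mem expand coords) (simp add: algebra_simps)
    moreover have "b i * (\<theta> i + \<theta> (Suc i))\<^sup>2
        = b i * \<theta> (Suc i) * \<theta> (Suc i) + 2 * (b i * \<theta> i * \<theta> (Suc i)) + b i * \<theta> i * \<theta> i"
      by (simp add: power2_eq_square algebra_simps)
    ultimately have "b i * (\<theta> i + \<theta> (Suc i))\<^sup>2 = b i * \<rho>" by (simp only: mult.commute)
    then show ?thesis using that b0 by (simp add: b_def)
  qed
  \<comment> \<open>This product of opposite entries does not change when the basis vectors are
    rescaled.\<close>
  define x where "x i = (if i = 0 then 0 else c i * b (i - 1))" for i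
  have rec: "2 * (\<theta> i + \<theta> (Suc i)) * x (Suc i) + 2 * (\<theta> i + \<theta> (i - 1)) * x i = 4 * \<beta>\<^sup>2 * \<theta> i"
    if "i \<le> ?d" for i
  proof -
    have "As (As (A (e i))) + scale 2 (As (A (As (e i)))) + A (As (As (e i)))
        = scale (4 * \<beta>\<^sup>2) (A (e i))"
      using cr eV by (simp add: cubic_relations_def)
    \<comment> \<open>In the second relation it is the component at \<open>i\<close> itself that
      matters: two applications of \<open>As\<close> return to \<open>i\<close> through either
      neighbour.\<close>
    from arg_cong[OF this, of "\<lambda>x. coord scale V v x i"] show ?thesis
      using that c00 by (cases i) (simp_all add: ne mem expand coords x_def algebra_simps)
  qed
  have x0: "x 0 = 0" by (simp add: x_def)
  have xd: "x (Suc ?d) = 0" by (simp add: x_def c_def)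
  have x1: "x 1 \<noteq> 0" using d b0(1)[of 0] c0(1)[of 1] by (simp add: x_def b_def c_def)
  obtain \<alpha> where ev: "even ?d" and \<alpha>: "\<rho> = 4 * \<alpha>\<^sup>2" "\<alpha> \<noteq> 0" and \<beta>: "4 * \<beta>\<^sup>2 \<noteq> 0"
    and th: "\<And>i. i \<le> ?d \<Longrightarrow> \<theta> i = \<alpha> * (- 1) ^ i * (of_nat ?d - 2 * of_nat i)"
    and xs: "\<And>i. i \<le> ?d \<Longrightarrow> 4 * x i = 4 * \<beta>\<^sup>2 * of_nat i * (of_nat ?d + 1 - of_nat i)"
    by (rule scalar_recurrences[OF d inj sq x0 xd x1 rec]) (assumption, assumption, rule that)
  have \<beta>0: "\<beta> \<noteq> 0" using \<beta> by auto
  \<comment> \<open>These factors turn the subdiagonal entries into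
    \<open>\<beta> * (of_nat ?d - of_nat j)\<close>. The superdiagonal entries then follow from the
    known products \<open>x i\<close>.\<close>
  define l where "l i = (\<Prod>j<i. b0 j / (\<beta> * (of_nat ?d - of_nat j)))" for i
  have dj: "of_nat ?d - of_nat j \<noteq> (0 :: 'k)" if "j < ?d" for j
    using that by simp
  have lSuc: "l (Suc i) * (\<beta> * (of_nat ?d - of_nat i)) = l i * b0 i" if "i < ?d" for i
    using dj[OF that] \<beta>0 by (simp add: l_def)
  have l0: "l i \<noteq> 0" if "i \<le> ?d" for i
    using that b0(1) dj \<beta>0 by (auto simp: l_def)
  have "krawtchouk_basis scale V \<alpha> \<beta> A As (\<lambda>i. scale (l i) (v i))"
    unfolding krawtchouk_basis_def
  proof (intro conjI allI impI indexed_basis_rescale[OF v] l0)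
    fix i assume i: "i \<le> ?d"
    show "A (scale (l i) (v i))
        = scale (\<alpha> * (- 1) ^ i * (of_nat ?d - 2 * of_nat i)) (scale (l i) (v i))"
      using i by (simp add: linear_map_onD(3)[OF linA indexed_basis_mem[OF v i]] eig th mult.commute)
    have up: "l i * b0 i = \<beta> * (of_nat ?d - of_nat i) * l (Suc i)"
      using i lSuc[of i] b0(2) by (cases "i = ?d") (auto simp: mult.commute)
    have down: "l i * c0 i = \<beta> * of_nat i * l (i - 1)"
    proof (cases i)
      case (Suc j)
      have j: "j < ?d" using i Suc by simp
      have "\<beta> * (of_nat ?d - of_nat j) * (l i * c0 i) = l j * x i"
        using lSuc[OF j] Suc i by (simp add: x_def b_def c_def algebra_simps)
      also have "x i = \<beta>\<^sup>2 * of_nat i * (of_nat ?d - of_nat j)"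
      proof -
        have "of_nat ?d + 1 - of_nat i = (of_nat ?d - of_nat j :: 'k)" by (simp add: Suc)
        with xs[OF i] have "4 * x i = 4 * (\<beta>\<^sup>2 * of_nat i * (of_nat ?d - of_nat j))"
          by (simp only: mult.assoc)
        then show ?thesis by (simp only: mult_cancel_left) simp
      qed
      finally have "\<beta> * (of_nat ?d - of_nat j) * (l i * c0 i)
          = \<beta> * (of_nat ?d - of_nat j) * (\<beta> * of_nat i * l j)"
        by (simp add: power2_eq_square mult_ac)
      then show ?thesis using dj[OF j] \<beta>0 Suc by simp
    qed (simp add: c0)
    show "As (scale (l i) (v i))
        = scale (\<beta> * (of_nat ?d - of_nat i)) (scale (l (Suc i)) (v (Suc i)))
          + scale (\<beta> * of_nat i) (scale (l (i - 1)) (v (i - 1)))"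
      using up down
      by (simp add: linear_map_onD(3)[OF linAs indexed_basis_mem[OF v i]] act[OF i] scale_right_distrib)
  qed
  then show thesis by (rule that[OF ev \<alpha> \<beta>0])
qed

section \<open>Change of sign and isomorphism of normal forms\<close>

text \<open>Under \<open>i\<close> to \<open>d - i\<close> the factor \<open>d - 2 * i\<close>
  changes sign, \<open>(- 1) ^ i\<close> does not because \<open>d\<close> is even, and the two
  coefficients of \<open>As\<close> change places.\<close>

lemma krawtchouk_basis_reverse:
  assumes "krawtchouk_basis scale V \<alpha> \<beta> A As w" "even (diameter scale V)" "vector_space scale"
  shows "krawtchouk_basis scale V (- \<alpha>) \<beta> A As (\<lambda>i. w (diameter scale V - i))"
  unfolding krawtchouk_basis_def
proof (intro conjI allI impI)
  let ?d = "diameter scale V"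
  interpret vector_space scale by fact
  show "indexed_basis scale V (\<lambda>i. w (?d - i))"
    using assms by (simp add: krawtchouk_basis_def indexed_basis_reverse)
  fix i assume i: "i \<le> ?d"
  have "(- 1) ^ (?d - i) = ((- 1) ^ i :: 'a)"
    using i assms(2) by (simp add: minus_one_power_iff)
  then have "\<alpha> * (- 1) ^ (?d - i) * (of_nat ?d - 2 * of_nat (?d - i))
      = - \<alpha> * (- 1) ^ i * (of_nat ?d - 2 * of_nat i)"
    using i by (simp add: of_nat_diff algebra_simps)
  then show "A (w (?d - i)) = scale (- \<alpha> * (- 1) ^ i * (of_nat ?d - 2 * of_nat i)) (w (?d - i))"
    using assms(1) by (simp add: krawtchouk_basis_def)
  have "As (w (?d - i)) = scale (\<beta> * of_nat i) (w (Suc (?d - i)))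
      + scale (\<beta> * (of_nat ?d - of_nat i)) (w (?d - i - 1))"
    using assms(1) i by (simp add: krawtchouk_basis_def of_nat_diff)
  \<comment> \<open>At \<open>i = 0\<close> the two vectors may differ, but their coefficient is
    zero.\<close>
  moreover have "scale (\<beta> * of_nat i) (w (Suc (?d - i))) = scale (\<beta> * of_nat i) (w (?d - (i - 1)))"
    using i by (cases i) (auto simp: Suc_diff_Suc)
  ultimately show "As (w (?d - i)) = scale (\<beta> * (of_nat ?d - of_nat i)) (w (?d - Suc i))
      + scale (\<beta> * of_nat i) (w (?d - (i - 1)))"
    by (simp add: add.commute)
qed

text \<open>The normal form depends only on the diameter, \<alpha> and \<beta>, so the linear map
  that matches the two bases intertwines both pairs.\<close>

lemma krawtchouk_bases_isomorphic:
  assumes "vector_space sV" "vector_space sW"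
    and linA: "linear_map_on sV sV V V A" and linAs: "linear_map_on sV sV V V As"
    and linB: "linear_map_on sW sW W W B" and linBs: "linear_map_on sW sW W W Bs"
    and diam: "diameter sW W = diameter sV V"
    and kv: "krawtchouk_basis sV V \<alpha> \<beta> A As v" and kw: "krawtchouk_basis sW W \<alpha> \<beta> B Bs w"
  shows "isomorphic_pairs sV V A As sW W B Bs"
proof -
  interpret V: vector_space sV by fact
  interpret W: vector_space sW by fact
  let ?d = "diameter sV V"
  have v: "indexed_basis sV V v" and w: "indexed_basis sW W w"
    using kv kw by (auto simp: krawtchouk_basis_def)
  note subV = V.indexed_basis_subspace[OF v] and subW = W.indexed_basis_subspace[OF w]
  note vV = V.indexed_basis_mem[OF v] and wW = W.indexed_basis_mem[OF w, unfolded diam]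
  note expV = V.coord_expand[OF v] and expW = W.coord_expand[OF w, unfolded diam]
  define \<phi> where "\<phi> x = (\<Sum>i\<le>?d. sW (coord sV V v x i) (w i))" for x
  have lin: "linear_map_on sV sW V W \<phi>"
    unfolding linear_map_on_def
  proof (intro conjI ballI allI)
    show "\<phi> x \<in> W" for x
      unfolding \<phi>_def using wW by (intro W.subspace_sum[OF subW] W.subspace_scale[OF subW]) auto
    show "\<phi> (x + y) = \<phi> x + \<phi> y" if "x \<in> V" "y \<in> V" for x y
      by (simp add: \<phi>_def V.coord_add[OF v that] W.scale_left_distrib sum.distrib)
    show "\<phi> (sV c x) = sW c (\<phi> x)" if "x \<in> V" for c x
      by (simp add: \<phi>_def V.coord_scale[OF v that] W.scale_sum_right)
  qed
  have \<phi>v: "\<phi> (v i) = w i" if "i \<le> ?d" for i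
  proof -
    have "\<phi> (v i) = (\<Sum>k\<le>?d. sW (if k = i then 1 else 0) (w k))"
      unfolding \<phi>_def using that by (intro sum.cong refl) (simp add: V.coord_basis[OF v])
    also have "\<dots> = w i" using that by (subst sum_up_to_single[of i]) auto
    finally show ?thesis .
  qed
  have bij: "bij_betw \<phi> V W"
    unfolding bij_betw_def
  proof
    show "inj_on \<phi> V"
    proof (rule inj_onI)
      fix x y assume xy: "x \<in> V" "y \<in> V" "\<phi> x = \<phi> y"
      have c: "coord sW W w (\<phi> z) i = coord sV V v z i" if "i \<le> ?d" for z i
        unfolding \<phi>_def by (rule W.coord_combination[OF w, unfolded diam, OF that])
      have "coord sV V v x i = coord sV V v y i" if "i \<le> ?d" for i
        unfolding c[OF that, symmetric] xy(3) ..
      then have "(\<Sum>i\<le>?d. sV (coord sV V v x i) (v i)) = (\<Sum>i\<le>?d. sV (coord sV V v y i) (v i))"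
        by (intro sum.cong refl) simp
      then show "x = y" unfolding expV[OF xy(1)] expV[OF xy(2)] .
    qed
    show "\<phi> ` V = W"
    proof
      show "\<phi> ` V \<subseteq> W" using linear_map_onD(1)[OF lin] by blast
      show "W \<subseteq> \<phi> ` V"
      proof
        fix y assume y: "y \<in> W"
        let ?x = "\<Sum>i\<le>?d. sV (coord sW W w y i) (v i)"
        have "?x \<in> V"
          using vV by (intro V.subspace_sum[OF subV] V.subspace_scale[OF subV]) auto
        moreover have "\<phi> ?x = (\<Sum>i\<le>?d. sW (coord sW W w y i) (w i))"
          unfolding \<phi>_def using V.coord_combination[OF v] by (intro sum.cong refl) simp
        ultimately show "y \<in> \<phi> ` V" unfolding expW[OF y] by (intro image_eqI[of y \<phi> ?x]) simp_all
      qed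
    qed
  qed
  \<comment> \<open>By linearity, commutation has to be checked on basis vectors only.\<close>
  have intertwine: "\<phi> (f x) = g (\<phi> x)"
    if f: "linear_map_on sV sV V V f" and g: "linear_map_on sW sW W W g"
      and fg: "\<And>i. i \<le> ?d \<Longrightarrow> \<phi> (f (v i)) = g (w i)" and x: "x \<in> V" for f g x
  proof -
    have "\<phi> (f x) = \<phi> (f (\<Sum>i\<le>?d. sV (coord sV V v x i) (v i)))"
      using expV[OF x] by simp
    also have "\<dots> = \<phi> (\<Sum>i\<le>?d. sV (coord sV V v x i) (f (v i)))"
      using vV by (subst V.linear_map_on_sum[OF subV f V.vector_space_axioms]) auto
    also have "\<dots> = (\<Sum>i\<le>?d. sW (coord sV V v x i) (\<phi> (f (v i))))"
      using vV linear_map_onD(1)[OF f]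
      by (intro V.linear_map_on_sum[OF subV lin W.vector_space_axioms]) auto
    also have "\<dots> = (\<Sum>i\<le>?d. sW (coord sV V v x i) (g (w i)))"
      by (intro sum.cong refl) (simp add: fg)
    also have "\<dots> = g (\<phi> x)"
      unfolding \<phi>_def using wW
      by (intro W.linear_map_on_sum[OF subW g W.vector_space_axioms, symmetric]) auto
    finally show ?thesis .
  qed
  have A: "\<phi> (A (v i)) = B (w i)" if i: "i \<le> ?d" for i
    using kv kw i diam vV[OF i]
    by (simp add: krawtchouk_basis_def \<phi>v linear_map_onD(3)[OF lin])
  have As: "\<phi> (As (v i)) = Bs (w i)" if i: "i \<le> ?d" for i
  proof -
    have Bs: "Bs (w i) = sW (\<beta> * (of_nat ?d - of_nat i)) (w (Suc i)) + sW (\<beta> * of_nat i) (w (i - 1))"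
      using kw i diam by (simp add: krawtchouk_basis_def)
    have As: "As (v i) = sV (\<beta> * (of_nat ?d - of_nat i)) (v (Suc i)) + sV (\<beta> * of_nat i) (v (i - 1))"
      using kv i by (simp add: krawtchouk_basis_def)
    have pred: "v (i - 1) \<in> V" "\<phi> (v (i - 1)) = w (i - 1)" using vV \<phi>v i by auto
    \<comment> \<open>At \<open>i = ?d\<close> the vector \<open>v (Suc i)\<close> may lie outside
      \<open>V\<close>, but its coefficient vanishes.\<close>
    show ?thesis
    proof (cases "i = ?d")
      case True
      then show ?thesis
        unfolding As Bs using pred by (simp add: linear_map_onD(3)[OF lin])
    next
      case False
      then have "v (Suc i) \<in> V" "\<phi> (v (Suc i)) = w (Suc i)" using vV \<phi>v i by auto
      then show ?thesis
        unfolding As Bs using pred by (simp add: linear_map_onD(2,3)[OF lin] V.subspace_scale[OF subV])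
    qed
  qed
  show ?thesis
    unfolding isomorphic_pairs_def
  proof (intro exI conjI ballI)
    show "\<phi> (A x) = B (\<phi> x)" if "x \<in> V" for x by (rule intertwine[OF linA linB A that])
    show "\<phi> (As x) = Bs (\<phi> x)" if "x \<in> V" for x by (rule intertwine[OF linAs linBs As that])
  qed (fact lin bij)+
qed

section \<open>From the normal form back to Leonard pairs\<close>

text \<open>Irreducibility rests on characteristic zero: the integers \<open>d - i\<close> and
  \<open>i + 1\<close> that occur off the diagonal stay nonzero.\<close>

lemma krawtchouk_standard_basis:
  fixes scale :: "'k::field_char_0 \<Rightarrow> 'v::ab_group_add \<Rightarrow> 'v"
  assumes "vector_space scale" and k: "krawtchouk_basis scale V \<alpha> \<beta> A As w" and \<beta>: "\<beta> \<noteq> 0"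
  shows "standard_basis scale V A As w" "bipartite_mat (matrix_wrt scale V w As)"
proof -
  interpret vector_space scale by fact
  let ?d = "diameter scale V" and ?M = "matrix_wrt scale V w As"
  have w: "indexed_basis scale V w" using k by (simp add: krawtchouk_basis_def)
  note mem = indexed_basis_mem[OF w] and sub = indexed_basis_subspace[OF w]
  have "matrix_wrt scale V w A $$ (i, j) = 0" if "i \<le> ?d" "j \<le> ?d" "i \<noteq> j" for i j
    using k that mem[of j]
    by (simp add: matrix_wrt_entry krawtchouk_basis_def coord_scale[OF w] coord_basis[OF w])
  then have diag: "diagonal_mat (matrix_wrt scale V w A)"
    by (auto simp: diagonal_mat_def)
  have entry: "?M $$ (i, j) = (if i = Suc j then \<beta> * (of_nat ?d - of_nat j) else 0)
      + (if j = Suc i then \<beta> * of_nat j else 0)" if ij: "i \<le> ?d" "j \<le> ?d" for i j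
  proof -
    have As: "As (w j) = scale (\<beta> * (of_nat ?d - of_nat j)) (w (Suc j))
        + scale (\<beta> * of_nat j) (w (j - 1))"
      using k ij by (simp add: krawtchouk_basis_def)
    have pred: "w (j - 1) \<in> V" using mem ij by simp
    have c: "coord scale V w (scale (\<beta> * of_nat j) (w (j - 1))) i
        = (if j = Suc i then \<beta> * of_nat j else 0)"
      using ij pred by (cases j) (auto simp: coord_scale[OF w] coord_basis[OF w] coord_zero)
    show ?thesis
    proof (cases "j = ?d")
      case True
      then have "As (w j) = scale (\<beta> * of_nat j) (w (j - 1))" unfolding As by simp
      then show ?thesis using ij c True by (simp only: matrix_wrt_entry) auto
    next
      case False
      then have "w (Suc j) \<in> V" using mem ij by simp
      then show ?thesis
        using False ij c pred
        by (simp add: matrix_wrt_entry As coord_add[OF w] subspace_scale[OF sub] coord_scale[OF w]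
            coord_basis[OF w])
    qed
  qed
  have tri: "tridiagonal_mat ?M"
    by (auto simp: tridiagonal_mat_def entry split: if_splits)
  then show "bipartite_mat ?M" by (simp add: bipartite_mat_def entry)
  have "of_nat ?d - of_nat i \<noteq> (0 :: 'k)" if "i < ?d" for i
    using that by simp
  moreover have "of_nat (Suc i) \<noteq> (0 :: 'k)" for i
    by (rule of_nat_neq_0)
  ultimately have "irreducible_tridiagonal_mat ?M"
    using tri \<beta> by (simp add: irreducible_tridiagonal_mat_def entry del: of_nat_Suc)
  with w diag show "standard_basis scale V A As w" by (simp add: standard_basis_def)
qed

text \<open>The left side multiplies each neighbour component of \<open>As (w i)\<close> by the
  square of a sum of adjacent eigenvalues, and these squares all equal
  \<open>4 * \<alpha>\<^sup>2\<close>. The second cubic relation is the same statement with the two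
  maps interchanged.\<close>

lemma (in vector_space) krawtchouk_cubic_relation:
  assumes k: "krawtchouk_basis scale V \<alpha> \<beta> A As w"
    and linA: "linear_map_on scale scale V V A" and linAs: "linear_map_on scale scale V V As"
    and x: "x \<in> V"
  shows "A (A (As x)) + scale 2 (A (As (A x))) + As (A (A x)) = scale (4 * \<alpha>\<^sup>2) (As x)"
proof -
  let ?d = "diameter scale V"
  have w: "indexed_basis scale V w" using k by (simp add: krawtchouk_basis_def)
  note sub = indexed_basis_subspace[OF w]
  define \<theta> where "\<theta> i = \<alpha> * (- 1) ^ i * (of_nat ?d - 2 * of_nat i)" for i
  define b c where "b i = \<beta> * (of_nat ?d - of_nat i)" and "c i = \<beta> * of_nat i" for i
  define e where "e i = (if i \<le> ?d then w i else 0)" for i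
  have eV: "e i \<in> V" for i
    using indexed_basis_mem[OF w] subspace_0[OF sub] by (simp add: e_def)
  have Ae: "A (e i) = scale (\<theta> i) (e i)" for i
    using k linear_map_onD(3)[OF linA subspace_0[OF sub], of 0]
    by (simp add: e_def \<theta>_def krawtchouk_basis_def)
  have Ase: "As (e i) = scale (b i) (e (Suc i)) + scale (c i) (e (i - 1))" if "i \<le> ?d" for i
  proof -
    have "As (w i) = scale (b i) (w (Suc i)) + scale (c i) (w (i - 1))"
      using k that by (simp add: b_def c_def krawtchouk_basis_def)
    then show ?thesis
      using that by (cases "i = ?d") (auto simp: e_def b_def)
  qed
  note mem = eV subspace_add[OF sub] subspace_scale[OF sub]
    linear_map_onD(1)[OF linA] linear_map_onD(1)[OF linAs]
  note expand = linear_map_onD(2,3)[OF linA] linear_map_onD(2,3)[OF linAs] Ae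
  have sq: "(\<theta> i + \<theta> (Suc i))\<^sup>2 = 4 * \<alpha>\<^sup>2" for i
  proof -
    have "\<theta> i + \<theta> (Suc i) = 2 * \<alpha> * (- 1) ^ i"
      by (simp add: \<theta>_def algebra_simps)
    then show ?thesis by (simp add: power_mult_distrib flip: power_mult)
  qed
  let ?F = "\<lambda>x. A (A (As x)) + scale 2 (A (As (A x))) + As (A (A x))"
  have basis: "?F (w i) = scale (4 * \<alpha>\<^sup>2) (As (w i))" if i: "i \<le> ?d" for i
  proof -
    have "?F (e i) = scale (b i * (\<theta> i + \<theta> (Suc i))\<^sup>2) (e (Suc i))
        + scale (c i * (\<theta> (i - 1) + \<theta> i)\<^sup>2) (e (i - 1))"
    proof -
      let ?p = "e (Suc i)" and ?q = "e (i - 1)"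
      have "A (A (As (e i))) = scale (b i * \<theta> (Suc i) * \<theta> (Suc i)) ?p
          + scale (c i * \<theta> (i - 1) * \<theta> (i - 1)) ?q"
        by (simp add: Ase[OF i] mem expand)
      moreover have "A (As (A (e i))) = scale (\<theta> i * b i * \<theta> (Suc i)) ?p
          + scale (\<theta> i * c i * \<theta> (i - 1)) ?q"
        by (simp add: Ase[OF i] mem expand scale_right_distrib mult.assoc)
      moreover have "As (A (A (e i))) = scale (\<theta> i * \<theta> i * b i) ?p + scale (\<theta> i * \<theta> i * c i) ?q"
        by (simp add: Ase[OF i] mem expand scale_right_distrib mult.assoc)
      moreover have "scale x ?p + scale y ?q + scale 2 (scale x' ?p + scale y' ?q)
          + (scale x'' ?p + scale y'' ?q) = scale (x + 2 * x' + x'') ?p + scale (y + 2 * y' + y'') ?q"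
        for x y x' y' x'' y''
        by (simp add: scale_right_distrib scale_left_distrib)
      moreover have "b i * \<theta> (Suc i) * \<theta> (Suc i) + 2 * (\<theta> i * b i * \<theta> (Suc i)) + \<theta> i * \<theta> i * b i
          = b i * (\<theta> i + \<theta> (Suc i))\<^sup>2"
        by (simp add: power2_eq_square algebra_simps)
      moreover have "c i * \<theta> (i - 1) * \<theta> (i - 1) + 2 * (\<theta> i * c i * \<theta> (i - 1)) + \<theta> i * \<theta> i * c i
          = c i * (\<theta> (i - 1) + \<theta> i)\<^sup>2"
        by (simp add: power2_eq_square algebra_simps)
      ultimately show ?thesis by (simp only:)
    qed
    \<comment> \<open>For \<open>i = 0\<close> there is no lower neighbour, and
      \<open>c 0 = 0\<close>.\<close>
    also have "c i * (\<theta> (i - 1) + \<theta> i)\<^sup>2 = c i * (4 * \<alpha>\<^sup>2)"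
      using sq[of "i - 1"] by (cases i) (simp_all add: c_def)
    finally have "?F (e i) = scale (4 * \<alpha>\<^sup>2) (As (e i))"
      unfolding sq Ase[OF i] by (simp add: scale_right_distrib mult.commute)
    then show ?thesis using i by (simp add: e_def)
  qed
  have linF: "linear_map_on scale scale V V ?F"
    unfolding linear_map_on_def
    by (simp add: mem linear_map_onD(2,3)[OF linA] linear_map_onD(2,3)[OF linAs]
        scale_right_distrib ac_simps)
  have linG: "linear_map_on scale scale V V (\<lambda>x. scale (4 * \<alpha>\<^sup>2) (As x))"
    unfolding linear_map_on_def
    by (simp add: mem linear_map_onD(2,3)[OF linAs] scale_right_distrib mult.commute)
  let ?x = "\<Sum>i\<le>?d. scale (coord scale V w x i) (w i)"
  have "?F ?x = (\<Sum>i\<le>?d. scale (coord scale V w x i) (?F (w i)))"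
    by (rule linear_map_on_sum[OF sub linF vector_space_axioms]) (simp add: indexed_basis_mem[OF w])
  also have "\<dots> = (\<Sum>i\<le>?d. scale (coord scale V w x i) (scale (4 * \<alpha>\<^sup>2) (As (w i))))"
    by (intro sum.cong refl) (simp only: basis atMost_iff)
  also have "\<dots> = scale (4 * \<alpha>\<^sup>2) (As ?x)"
    by (rule linear_map_on_sum[OF sub linG vector_space_axioms, symmetric])
      (simp add: indexed_basis_mem[OF w])
  finally show ?thesis unfolding coord_expand[OF w x] .
qed

text \<open>The numerator is minus the denominator identically. The denominator is nonzero because
  it contains the odd integer \<open>d - 2 * j - 3\<close>, where \<open>i = j + 2\<close>.\<close>

lemma krawtchouk_eigenvalue_quotient:
  fixes \<alpha> :: "'k::field_char_0"
  assumes "even d" "\<alpha> \<noteq> 0" "2 \<le> i"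
  defines "\<theta> \<equiv> \<lambda>i. \<alpha> * (- 1) ^ i * (of_nat d - 2 * of_nat i)"
  shows "(\<theta> (i - 2) - \<theta> (i + 1)) / (\<theta> (i - 1) - \<theta> i) = - 1"
proof -
  obtain j where j: "i = Suc (Suc j)" using assms(3) by (metis add_2_eq_Suc le_Suc_ex)
  have "of_int (int d - 2 * int j - 3) \<noteq> (0 :: 'k)"
    using assms(1) by (subst of_int_eq_0_iff) presburger
  then have "of_nat d - 2 * of_nat j - 3 \<noteq> (0 :: 'k)" by simp
  moreover have "\<theta> (i - 1) - \<theta> i = - 2 * \<alpha> * (- 1) ^ j * (of_nat d - 2 * of_nat j - 3)"
    by (simp add: \<theta>_def j algebra_simps)
  ultimately have "\<theta> (i - 1) - \<theta> i \<noteq> 0" using assms(2) by simp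
  moreover have "\<theta> (i - 2) - \<theta> (i + 1) = - (\<theta> (i - 1) - \<theta> i)"
    by (simp add: \<theta>_def j algebra_simps)
  ultimately show ?thesis by (metis divide_self minus_divide_left)
qed

text \<open>Each of the two normal forms accounts for one half of every condition: one basis, one
  bipartite matrix, one eigenvalue sequence and one cubic relation.\<close>

lemma krawtchouk_tb_bi_leonard_pair:
  fixes scale :: "'k::field_char_0 \<Rightarrow> 'v::ab_group_add \<Rightarrow> 'v"
  assumes "vector_space scale" and dim: "vector_space.dim scale V = Suc d"
    and linA: "linear_map_on scale scale V V A" and linAs: "linear_map_on scale scale V V As"
    and k: "krawtchouk_basis scale V \<alpha> \<beta> A As w" and ks: "krawtchouk_basis scale V \<beta> \<alpha> As A ws"
    and ab: "\<alpha> \<noteq> 0" "\<beta> \<noteq> 0" and ev: "even d"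
  shows "tb_bi_leonard_pair scale d (4 * \<alpha>\<^sup>2) (4 * \<beta>\<^sup>2) V A As"
proof -
  interpret vector_space scale by fact
  have diam: "diameter scale V = d" using dim by (simp add: diameter_def)
  have w: "indexed_basis scale V w" using k by (simp add: krawtchouk_basis_def)
  note sb = krawtchouk_standard_basis[OF vector_space_axioms k ab(2)]
    and sbs = krawtchouk_standard_basis[OF vector_space_axioms ks ab(1)]
  have "cubic_relations scale (4 * \<alpha>\<^sup>2) (4 * \<beta>\<^sup>2) V A As"
    unfolding cubic_relations_def
    by (intro conjI ballI krawtchouk_cubic_relation[OF k linA linAs]
        krawtchouk_cubic_relation[OF ks linAs linA])
  moreover have "leonard_pair scale V A As"
    unfolding leonard_pair_def
  proof (intro conjI)
    show "\<exists>v. standard_basis scale V A As v" using sb(1) by (rule exI[of _ w])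
    show "\<exists>vs. standard_basis scale V As A vs" using sbs(1) by (rule exI[of _ ws])
  qed (simp_all add: dim linA linAs vector_space_axioms indexed_basis_subspace[OF w])
  moreover have "totally_bipartite scale V A As"
    unfolding totally_bipartite_def
  proof
    show "\<exists>v. standard_basis scale V A As v \<and> bipartite_mat (matrix_wrt scale V v As)"
      using sb by (intro exI[of _ w] conjI)
    show "\<exists>vs. standard_basis scale V As A vs \<and> bipartite_mat (matrix_wrt scale V vs A)"
      using sbs by (intro exI[of _ ws] conjI)
  qed
  moreover have "bannai_ito_type scale V A As"
    unfolding bannai_ito_type_def
  proof (intro exI conjI)
    show "standard_basis scale V A As w" "standard_basis scale V As A ws"
      by (fact sb(1) sbs(1))+
    show "\<forall>i\<le>diameter scale V. A (w i) = scale (\<alpha> * (- 1) ^ i * (of_nat d - 2 * of_nat i)) (w i)"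
      "\<forall>i\<le>diameter scale V. As (ws i) = scale (\<beta> * (- 1) ^ i * (of_nat d - 2 * of_nat i)) (ws i)"
      using k ks by (auto simp: krawtchouk_basis_def diam)
  qed (intro ballI conjI krawtchouk_eigenvalue_quotient[OF ev] ab; simp)
  ultimately show ?thesis by (simp add: tb_bi_leonard_pair_def diam)
qed

section \<open>The model on sequences\<close>

text \<open>The sequence \<open>f\<close> with support in \<open>{..d}\<close> stands for the form
  \<open>\<Sum>n. f n x^(d - n) y^n\<close>. Up to scalars, \<open>As\<close> is \<open>x d/dy + y d/dx\<close> and \<open>A\<close> is \<open>x d/dx - y d/dy\<close>
  followed by the substitution \<open>y \<mapsto> -y\<close>. The eigenvectors of \<open>As\<close> are the products
  \<open>(x + y)^(d - j) (x - y)^j\<close>; below \<open>x\<close> is set to \<open>1\<close>.\<close>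

definition seq_space :: "nat \<Rightarrow> (nat \<Rightarrow> 'k::field) set" where
  "seq_space d = {f. \<forall>n>d. f n = 0}"

definition seq_A :: "'k::field \<Rightarrow> nat \<Rightarrow> (nat \<Rightarrow> 'k) \<Rightarrow> nat \<Rightarrow> 'k" where
  "seq_A \<alpha> d f n = \<alpha> * (- 1) ^ n * (of_nat d - 2 * of_nat n) * f n"

definition seq_As :: "'k::field \<Rightarrow> nat \<Rightarrow> (nat \<Rightarrow> 'k) \<Rightarrow> nat \<Rightarrow> 'k" where
  "seq_As \<beta> d f n = \<beta> * ((of_nat d + 1 - of_nat n) * (if n = 0 then 0 else f (n - 1))
     + of_nat (Suc n) * f (Suc n))"

definition unit_seq :: "nat \<Rightarrow> nat \<Rightarrow> 'k::field" where
  "unit_seq i n = (if n = i then 1 else 0)"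

definition krawtchouk_poly :: "nat \<Rightarrow> nat \<Rightarrow> 'k::field_char_0 poly" where
  "krawtchouk_poly d j = [:1, 1:] ^ (d - j) * [:1, -1:] ^ j"

lemma sum_fun_apply: "(\<Sum>i\<in>I. g i) n = (\<Sum>i\<in>I. g i n)"
  by (induction I rule: infinite_finite_induct) auto

text \<open>The dimension is computed along the way, since \<open>indexed_basis\<close> refers to it
  through \<open>diameter\<close>.\<close>

lemma unit_seq_basis:
  "vector_space.dim seq_scale (seq_space d :: (nat \<Rightarrow> 'k::field) set) = Suc d"
  "indexed_basis seq_scale (seq_space d :: (nat \<Rightarrow> 'k::field) set) unit_seq"
proof -
  interpret vector_space "seq_scale :: 'k \<Rightarrow> _" by (rule vector_space_seq_scale)
  let ?V = "seq_space d :: (nat \<Rightarrow> 'k) set" and ?B = "(unit_seq :: nat \<Rightarrow> nat \<Rightarrow> 'k) ` {..d}"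
  have comb: "(\<Sum>i\<le>d. seq_scale (f i) (unit_seq i)) n = (if n \<le> d then f n else 0)"
    for f :: "nat \<Rightarrow> 'k" and n
    by (simp add: sum_fun_apply seq_scale_def unit_seq_def if_distrib[of "\<lambda>x. _ * x"] sum.delta
        cong: if_cong)
  have inj: "inj_on (unit_seq :: nat \<Rightarrow> nat \<Rightarrow> 'k) {..d}"
    by (rule inj_onI) (metis unit_seq_def zero_neq_one)
  have ind: "independent ?B"
  proof (rule independent_if_scalars_zero)
    fix f :: "(nat \<Rightarrow> 'k) \<Rightarrow> 'k" and x
    assume f: "(\<Sum>x\<in>?B. seq_scale (f x) x) = 0" and "x \<in> ?B"
    then obtain i where i: "i \<le> d" "x = unit_seq i" by blast
    have "(\<Sum>i\<le>d. seq_scale (f (unit_seq i)) (unit_seq i)) i = (0 :: 'k)"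
      using f by (simp add: sum.reindex[OF inj])
    then show "f x = 0" using comb[of "\<lambda>i. f (unit_seq i)" i] i by simp
  qed simp
  have sp: "span ?B = ?V"
  proof
    have "subspace ?V" by (auto simp: subspace_def seq_space_def seq_scale_def)
    then show "span ?B \<subseteq> ?V"
      by (intro span_minimal) (auto simp: seq_space_def unit_seq_def)
    show "?V \<subseteq> span ?B"
    proof
      fix f assume f: "f \<in> ?V"
      have "f = (\<Sum>i\<le>d. seq_scale (f i) (unit_seq i))"
        using f by (intro ext) (auto simp: comb seq_space_def)
      also have "\<dots> \<in> span ?B" by (intro span_sum span_scale span_base) auto
      finally show "f \<in> span ?B" .
    qed
  qed
  show dim: "vector_space.dim seq_scale ?V = Suc d"
    using dim_span_eq_card_independent[OF ind] by (simp add: sp card_image[OF inj])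
  show "indexed_basis seq_scale ?V unit_seq"
    using inj ind sp by (simp add: indexed_basis_def diameter_def dim)
qed

lemma linear_map_on_seq_A: "linear_map_on seq_scale seq_scale (seq_space d) (seq_space d) (seq_A \<alpha> d)"
  by (auto simp: linear_map_on_def seq_space_def seq_scale_def seq_A_def fun_eq_iff algebra_simps)

lemma linear_map_on_seq_As: "linear_map_on seq_scale seq_scale (seq_space d) (seq_space d) (seq_As \<beta> d)"
  unfolding linear_map_on_def
proof (intro conjI ballI allI)
  fix f :: "nat \<Rightarrow> 'a" assume f: "f \<in> seq_space d"
  \<comment> \<open>At \<open>n = Suc d\<close> the shifted value \<open>f d\<close> may be nonzero,
    but its factor \<open>d + 1 - n\<close> is zero.\<close>
  have "seq_As \<beta> d f n = 0" if "n > d" for n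
    using f that by (cases "n = Suc d") (auto simp: seq_As_def seq_space_def)
  then show "seq_As \<beta> d f \<in> seq_space d" by (simp add: seq_space_def)
qed (auto simp: seq_scale_def seq_As_def fun_eq_iff algebra_simps)

lemma krawtchouk_basis_unit_seq:
  "krawtchouk_basis seq_scale (seq_space d) \<alpha> \<beta> (seq_A \<alpha> d) (seq_As \<beta> d)
    (unit_seq :: nat \<Rightarrow> nat \<Rightarrow> 'k::field)"
  unfolding krawtchouk_basis_def
proof (intro conjI allI impI ext)
  have diam: "diameter seq_scale (seq_space d :: (nat \<Rightarrow> 'k) set) = d"
    by (simp add: diameter_def unit_seq_basis)
  show "indexed_basis seq_scale (seq_space d) (unit_seq :: nat \<Rightarrow> nat \<Rightarrow> 'k)"
    by (rule unit_seq_basis)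
  fix i n
  show "seq_A \<alpha> d (unit_seq i) n = seq_scale (\<alpha> * (- 1) ^ i *
      (of_nat (diameter seq_scale (seq_space d :: (nat \<Rightarrow> 'k) set)) - 2 * of_nat i)) (unit_seq i) n"
    by (simp add: seq_A_def unit_seq_def seq_scale_def diam)
  show "seq_As \<beta> d (unit_seq i) n
      = (seq_scale (\<beta> * (of_nat (diameter seq_scale (seq_space d :: (nat \<Rightarrow> 'k) set)) - of_nat i))
          (unit_seq (Suc i)) + seq_scale (\<beta> * of_nat i) (unit_seq (i - 1))) n"
    by (cases n; cases i) (auto simp: seq_As_def unit_seq_def seq_scale_def diam)
qed

section \<open>Generating polynomials of the dual eigenbasis\<close>

text \<open>The extra factor \<open>p\<close> avoids the exponent \<open>n - 1\<close>.\<close>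

lemma mult_pderiv_power:
  fixes p :: "'k::field_char_0 poly"
  shows "p * pderiv (p ^ n) = of_nat n * pderiv p * p ^ n"
proof (cases n)
  case (Suc m)
  then have "pderiv (p ^ n) = Polynomial.smult (of_nat n) (p ^ m * pderiv p)"
    using pderiv_power[of p n] by simp
  then show ?thesis by (simp add: Suc of_nat_poly algebra_simps del: of_nat_Suc)
qed simp

text \<open>This is the logarithmic derivative of \<open>(1 + y)^(d - j) (1 - y)^j\<close>, cleared
  of denominators.\<close>

lemma mult_pderiv_krawtchouk_poly:
  "[:1, 1:] * [:1, -1:] * pderiv (krawtchouk_poly d j)
    = (of_nat (d - j) * [:1, -1:] - of_nat j * [:1, 1:]) * (krawtchouk_poly d j :: 'k::field_char_0 poly)"
proof -
  define s t :: "'k poly" where "s = [:1, 1:]" and "t = [:1, -1:]"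
  have "pderiv s = 1" "pderiv t = - 1" by (simp_all add: s_def t_def pderiv_pCons one_pCons)
  then have st: "s * pderiv (s ^ n) = of_nat n * s ^ n" "t * pderiv (t ^ n) = - (of_nat n * t ^ n)" for n
    unfolding mult_pderiv_power by simp_all
  have "s * t * pderiv (s ^ (d - j) * t ^ j)
      = (s * pderiv (s ^ (d - j))) * (t * t ^ j) + (s * s ^ (d - j)) * (t * pderiv (t ^ j))"
    unfolding pderiv_mult by (simp add: algebra_simps)
  also have "\<dots> = (of_nat (d - j) * t - of_nat j * s) * (s ^ (d - j) * t ^ j)"
    unfolding st by (simp add: algebra_simps)
  finally show ?thesis unfolding krawtchouk_poly_def s_def t_def .
qed

text \<open>The left side is \<open>x d/dy + y d/dx\<close> at \<open>x = 1\<close>, with the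
  \<open>x\<close>-derivative eliminated by Euler's identity for forms of degree \<open>d\<close>.
  As \<open>1 - y^2 = (1 + y) (1 - y)\<close>, the logarithmic derivative applies.\<close>

lemma krawtchouk_poly_eigen:
  fixes d j :: nat
  assumes "j \<le> d"
  defines "u \<equiv> krawtchouk_poly d j :: 'k::field_char_0 poly"
  shows "of_nat d * ([:0, 1:] * u) + (1 - [:0, 1:] * [:0, 1:]) * pderiv u = (of_nat d - 2 * of_nat j) * u"
proof -
  define X s t :: "'k poly" where "X = [:0, 1:]" and "s = [:1, 1:]" and "t = [:1, -1:]"
  have st: "s = 1 + X" "t = 1 - X" by (simp_all add: X_def s_def t_def one_pCons)
  have "(1 - X * X) * pderiv u = s * t * pderiv u" by (simp add: st algebra_simps)
  also have "\<dots> = (of_nat (d - j) * t - of_nat j * s) * u"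
    unfolding u_def s_def t_def by (rule mult_pderiv_krawtchouk_poly)
  finally show ?thesis
    unfolding X_def[symmetric] by (simp add: st of_nat_diff[OF assms(1)] algebra_simps)
qed

text \<open>The left side is the derivation \<open>x d/dx - y d/dy\<close> at \<open>x = 1\<close>.
  It interchanges \<open>x + y\<close> and \<open>x - y\<close>, so the product rule gives the two
  terms on the right.\<close>

lemma krawtchouk_poly_three_term:
  fixes d j :: nat
  assumes "j \<le> d"
  defines "u \<equiv> krawtchouk_poly d :: nat \<Rightarrow> 'k::field_char_0 poly"
  shows "of_nat d * u j - 2 * ([:0, 1:] * pderiv (u j))
    = of_nat (d - j) * u (Suc j) + of_nat j * u (j - 1)"
proof -
  define X s t :: "'k poly" where "X = [:0, 1:]" and "s = [:1, 1:]" and "t = [:1, -1:]"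
  have st: "s = 1 + X" "t = 1 - X" by (simp_all add: X_def s_def t_def one_pCons)
  have st0: "s * t \<noteq> 0" by (simp add: s_def t_def)
  have u: "u i = s ^ (d - i) * t ^ i" for i by (simp add: u_def krawtchouk_poly_def s_def t_def)
  have du: "s * t * pderiv (u j) = (of_nat (d - j) * t - of_nat j * s) * u j"
    unfolding u_def s_def t_def by (rule mult_pderiv_krawtchouk_poly)
  have step: "s * u (Suc i) = t * u i" if "i < d" for i
  proof -
    have "d - i = Suc (d - Suc i)" using that by simp
    then show ?thesis by (simp add: u mult_ac)
  qed
  have up: "of_nat (d - j) * (s * t * u (Suc j)) = of_nat (d - j) * (t * t * u j)"
    using step[of j] assms(1) by (cases "j = d") (simp_all add: mult_ac)
  have down: "of_nat j * (s * t * u (j - 1)) = of_nat j * (s * s * u j)"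
    using step[of "j - 1"] assms(1) by (cases j) (simp_all add: mult_ac)
  \<comment> \<open>Multiplication by \<open>s * t\<close> makes the formula for the derivative
    applicable, and the factor is cancelled at the end.\<close>
  have "s * t * (of_nat d * u j - 2 * (X * pderiv (u j)))
      = of_nat d * (s * t * u j) - 2 * (X * (s * t * pderiv (u j)))"
    by (simp add: algebra_simps)
  also have "\<dots> = of_nat (d - j) * (t * t * u j) + of_nat j * (s * s * u j)"
    unfolding du unfolding of_nat_diff[OF assms(1)] st by (simp add: algebra_simps)
  also have "\<dots> = s * t * (of_nat (d - j) * u (Suc j) + of_nat j * u (j - 1))"
    unfolding up[symmetric] down[symmetric] by (simp add: algebra_simps)
  finally show ?thesis using st0 unfolding X_def mult_cancel_left by simp
qed

lemma pcompose_power: "pcompose (p ^ n) q = pcompose p q ^ n"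
  for p q :: "'k::comm_semiring_1 poly"
  by (induction n) (simp_all add: pcompose_mult pcompose_1)

text \<open>The substitution of \<open>-y\<close> for \<open>y\<close> exchanges the factors
  \<open>1 + y\<close> and \<open>1 - y\<close>.\<close>

lemma krawtchouk_poly_reflect:
  assumes "j \<le> d"
  shows "(- 1) ^ n * coeff (krawtchouk_poly d j) n = coeff (krawtchouk_poly d (d - j)) (n :: nat)"
proof -
  have "pcompose (krawtchouk_poly d j :: 'a poly) [:0, -1:] = krawtchouk_poly d (d - j)"
    using assms by (simp add: krawtchouk_poly_def pcompose_mult pcompose_power pcompose_pCons mult.commute)
  then show ?thesis using coeff_pcompose_linear[of "krawtchouk_poly d j :: 'a poly" "-1" n] by simp
qed

lemma coeff_krawtchouk_poly_mem:
  assumes "j \<le> d"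
  shows "coeff (krawtchouk_poly d j) \<in> seq_space d"
proof -
  have "degree ([:1, 1:] ^ (d - j) :: 'a poly) \<le> d - j" "degree ([:1, -1:] ^ j :: 'a poly) \<le> j"
    using degree_power_le[of "[:1, 1:] :: 'a poly" "d - j"] degree_power_le[of "[:1, -1:] :: 'a poly" j]
    by simp_all
  then have "degree (krawtchouk_poly d j :: 'a poly) \<le> d"
    unfolding krawtchouk_poly_def using assms degree_mult_le[of "[:1, 1:] ^ (d - j) :: 'a poly" "[:1, -1:] ^ j"]
    by linarith
  then show ?thesis by (auto simp: seq_space_def intro: coeff_eq_0)
qed

lemma seq_A_coeff:
  "seq_A \<alpha> d (coeff p) n = \<alpha> * (- 1) ^ n * coeff (of_nat d * p - 2 * ([:0, 1:] * pderiv p)) n"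
  for p :: "'k::field_char_0 poly"
proof -
  have eq: "of_nat d * p - 2 * ([:0, 1:] * pderiv p)
      = Polynomial.smult (of_nat d) p - Polynomial.smult 2 (pCons 0 (pderiv p))"
    by (simp add: of_nat_poly numeral_poly)
  have "coeff (Polynomial.smult (of_nat d) p - Polynomial.smult 2 (pCons 0 (pderiv p))) n
      = (of_nat d - 2 * of_nat n) * coeff p n"
    by (cases n) (simp_all add: coeff_pderiv algebra_simps)
  then show ?thesis unfolding eq seq_A_def by (simp only: mult.assoc)
qed

lemma seq_As_coeff:
  "seq_As \<beta> d (coeff p) n
    = \<beta> * coeff (of_nat d * ([:0, 1:] * p) + (1 - [:0, 1:] * [:0, 1:]) * pderiv p) n"
  for p :: "'k::field_char_0 poly"
proof -
  have "of_nat d * ([:0, 1:] * p) + (1 - [:0, 1:] * [:0, 1:]) * pderiv p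
      = Polynomial.smult (of_nat d) (pCons 0 p) + pderiv p - pCons 0 (pCons 0 (pderiv p))"
    by (simp add: of_nat_poly left_diff_distrib)
  \<comment> \<open>Multiplication by \<open>y^2\<close> shifts coefficients by two, hence the three
    cases.\<close>
  moreover have "n = 0 \<or> n = 1 \<or> (\<exists>m. n = Suc (Suc m))" by presburger
  ultimately show ?thesis
    by (auto simp: seq_As_def coeff_pderiv algebra_simps)
qed

text \<open>Indices of equal parity carry the same sign and are compared directly. For indices of
  opposite parity equality would mean \<open>d = i + j\<close>, which is odd.\<close>

lemma inj_krawtchouk_eigenvalue:
  fixes \<beta> :: "'k::field_char_0"
  assumes "even d" "\<beta> \<noteq> 0"
  shows "inj_on (\<lambda>i. \<beta> * (- 1) ^ i * (of_nat d - 2 * of_nat i)) {..d}"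
proof (rule inj_onI)
  fix i j assume ij: "i \<in> {..d}" "j \<in> {..d}"
    "\<beta> * (- 1) ^ i * (of_nat d - 2 * of_nat i) = \<beta> * (- 1) ^ j * (of_nat d - 2 * of_nat j)"
  then have "of_int ((- 1) ^ i * (int d - 2 * int i)) = (of_int ((- 1) ^ j * (int d - 2 * int j)) :: 'k)"
    using assms(2) by simp
  then have e: "(- 1) ^ i * (int d - 2 * int i) = (- 1) ^ j * (int d - 2 * int j)"
    by (simp only: of_int_eq_iff)
  show "i = j"
  proof (cases "even i = even j")
    case True
    then have "(- 1) ^ i = ((- 1) ^ j :: int)" by (simp add: minus_one_power_iff)
    with e show ?thesis by simp
  next
    case False
    then have "(- 1) ^ i = - ((- 1) ^ j :: int)" by (simp add: minus_one_power_iff)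
    with e have "(- 1) ^ j * (int d - 2 * int i) = (- 1) ^ j * - (int d - 2 * int j)"
      by (simp only: mult_minus_left mult_minus_right)
    then have "int d - 2 * int i = - (int d - 2 * int j)"
      by (subst (asm) mult_cancel_left) simp
    then have "d = i + j" by linarith
    with assms(1) False show ?thesis by simp
  qed
qed

text \<open>The sign \<open>(- 1) ^ n\<close> in \<open>seq_A\<close> replaces index
  \<open>j\<close> by \<open>d - j\<close>, so \<open>seq_A\<close> joins the polynomial of index
  \<open>j\<close> to those of index \<open>d - j - 1\<close> and \<open>d - j + 1\<close>. Listing
  index \<open>i\<close> for even \<open>i\<close> and \<open>d - i\<close> for odd \<open>i\<close>
  makes this action tridiagonal and also produces the alternating sign of the eigenvalues of
  \<open>seq_As\<close>.\<close>

lemma krawtchouk_basis_coeff: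
  fixes \<alpha> \<beta> :: "'k::field_char_0"
  assumes "even d" "\<beta> \<noteq> 0"
  shows "krawtchouk_basis seq_scale (seq_space d) \<beta> \<alpha> (seq_As \<beta> d) (seq_A \<alpha> d)
    (\<lambda>i. coeff (krawtchouk_poly d (if even i then i else d - i)))"
proof -
  interpret vector_space "seq_scale :: 'k \<Rightarrow> _" by (rule vector_space_seq_scale)
  let ?V = "seq_space d :: (nat \<Rightarrow> 'k) set"
  have diam: "diameter seq_scale ?V = d" by (simp add: diameter_def unit_seq_basis)
  define u where "u j = coeff (krawtchouk_poly d j :: 'k poly)" for j
  define w where "w i = u (if even i then i else d - i)" for i
  have As: "seq_As \<beta> d (w i) = seq_scale (\<beta> * (- 1) ^ i * (of_nat d - 2 * of_nat i)) (w i)"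
    if "i \<le> d" for i
  proof
    fix n
    let ?j = "if even i then i else d - i"
    have j: "?j \<le> d" using that by simp
    have c: "(of_nat d - 2 * of_nat ?j :: 'k poly) = [:of_nat d - 2 * of_nat ?j:]"
      by (simp add: of_nat_poly numeral_poly)
    have "seq_As \<beta> d (w i) n = \<beta> * ((of_nat d - 2 * of_nat ?j) * w i n)"
      unfolding w_def u_def seq_As_coeff krawtchouk_poly_eigen[OF j] unfolding c by simp
    also have "of_nat d - 2 * of_nat ?j = (- 1) ^ i * (of_nat d - 2 * of_nat i :: 'k)"
      using that by (simp add: of_nat_diff)
    finally show "seq_As \<beta> d (w i) n
        = seq_scale (\<beta> * (- 1) ^ i * (of_nat d - 2 * of_nat i)) (w i) n"
      by (simp add: seq_scale_def mult.assoc)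
  qed
  have A: "seq_A \<alpha> d (w i) = seq_scale (\<alpha> * (of_nat d - of_nat i)) (w (Suc i))
      + seq_scale (\<alpha> * of_nat i) (w (i - 1))" if i: "i \<le> d" for i
  proof
    fix n
    \<comment> \<open>The three-term relation is combined with the reflection of both terms.\<close>
    have three: "seq_A \<alpha> d (u j) n = \<alpha> * (of_nat (d - j) * u (d - Suc j) n
        + of_nat j * u (Suc (d - j)) n)" if j: "j \<le> d" for j
    proof -
      have c: "of_nat m = ([:of_nat m:] :: 'k poly)" for m by (rule of_nat_poly)
      have "seq_A \<alpha> d (u j) n = \<alpha> * (of_nat (d - j) * ((- 1) ^ n * u (Suc j) n)
          + of_nat j * ((- 1) ^ n * u (j - 1) n))"
        unfolding u_def seq_A_coeff krawtchouk_poly_three_term[OF j] unfolding c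
        by (simp add: algebra_simps)
      also have "of_nat (d - j) * ((- 1) ^ n * u (Suc j) n) = of_nat (d - j) * u (d - Suc j) n"
        using j krawtchouk_poly_reflect[where 'a = 'k, of "Suc j" d n] by (cases "j = d") (simp_all add: u_def)
      also have "of_nat j * ((- 1) ^ n * u (j - 1) n) = of_nat j * u (Suc (d - j)) n"
        using j krawtchouk_poly_reflect[where 'a = 'k, of "j - 1" d n]
        by (cases j) (simp_all add: u_def Suc_diff_Suc)
      finally show ?thesis .
    qed
    have "seq_A \<alpha> d (w i) n = \<alpha> * ((of_nat d - of_nat i) * w (Suc i) n + of_nat i * w (i - 1) n)"
    proof (cases "even i")
      case True
      then show ?thesis
        using i three[OF i] by (cases i) (simp_all add: w_def of_nat_diff Suc_diff_Suc)
    next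
      case False
      \<comment> \<open>An odd \<open>i\<close> differs from the even \<open>d\<close>, so both
        neighbours are in range.\<close>
      then have "i \<noteq> d" using assms(1) by blast
      then obtain k where "i = Suc k" "Suc k < d" using False i by (cases i) auto
      then show ?thesis
        using False three[of "d - i"] by (simp add: w_def of_nat_diff add.commute)
    qed
    then show "seq_A \<alpha> d (w i) n = (seq_scale (\<alpha> * (of_nat d - of_nat i)) (w (Suc i))
        + seq_scale (\<alpha> * of_nat i) (w (i - 1))) n"
      by (simp add: seq_scale_def algebra_simps)
  qed
  have "indexed_basis seq_scale ?V w"
  proof (rule eigenvectors_indexed_basis[OF unit_seq_basis(2) linear_map_on_seq_As], unfold diam)
    show "w i \<in> ?V" if "i \<le> d" for i
      using that by (simp add: w_def u_def coeff_krawtchouk_poly_mem)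
    show "w i \<noteq> 0" for i
    proof -
      have "krawtchouk_poly d j \<noteq> (0 :: 'k poly)" for j by (simp add: krawtchouk_poly_def)
      then show ?thesis by (simp add: w_def u_def poly_eq_iff fun_eq_iff)
    qed
  qed (fact As inj_krawtchouk_eigenvalue[OF assms])+
  then have "krawtchouk_basis seq_scale ?V \<beta> \<alpha> (seq_As \<beta> d) (seq_A \<alpha> d) w"
    by (simp add: krawtchouk_basis_def diam As A)
  then show ?thesis by (simp add: w_def[abs_def] u_def)
qed

section \<open>Classification\<close>

text \<open>The first parameter of the normal form is determined up to sign, and reversal of the
  basis brings it to the prescribed root \<alpha>. Pairs with equal scalars therefore share one
  normal form.\<close>

lemma tb_bi_leonard_pair_krawtchouk_basis:
  fixes scale :: "'k::field_char_0 \<Rightarrow> 'v::ab_group_add \<Rightarrow> 'v"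
  assumes tb: "tb_bi_leonard_pair scale d (4 * \<alpha>\<^sup>2) (4 * \<beta>\<^sup>2) V A As" and d: "2 \<le> d"
  obtains w where "even d" "\<alpha> \<noteq> 0" "\<beta> \<noteq> 0" "krawtchouk_basis scale V \<alpha> \<beta> A As w"
proof -
  have lp: "leonard_pair scale V A As" and bip: "totally_bipartite scale V A As"
    and diam: "diameter scale V = d" and cr: "cubic_relations scale (4 * \<alpha>\<^sup>2) (4 * \<beta>\<^sup>2) V A As"
    using tb by (auto simp: tb_bi_leonard_pair_def)
  have vs: "vector_space scale" using lp by (simp add: leonard_pair_def)
  obtain \<gamma> w where ev: "even d" and eq: "4 * \<alpha>\<^sup>2 = 4 * \<gamma>\<^sup>2" and nz: "\<gamma> \<noteq> 0" "\<beta> \<noteq> 0"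
    and w: "krawtchouk_basis scale V \<gamma> \<beta> A As w"
    using krawtchouk_basis_exists[OF lp bip cr] d unfolding diam by metis
  from eq have "\<gamma> = \<alpha> \<or> \<gamma> = - \<alpha>" by (auto simp: power2_eq_iff)
  then show thesis
  proof
    assume "\<gamma> = \<alpha>"
    with that[OF ev] nz w show thesis by simp
  next
    assume "\<gamma> = - \<alpha>"
    with krawtchouk_basis_reverse[OF w _ vs] ev
    have "krawtchouk_basis scale V \<alpha> \<beta> A As (\<lambda>i. w (diameter scale V - i))" by (simp add: diam)
    with that[OF ev] nz \<open>\<gamma> = - \<alpha>\<close> show thesis by simp
  qed
qed

lemma ex_four_times_square: "\<exists>\<alpha>. x = 4 * \<alpha>\<^sup>2" for x :: "'k::{alg_closed_field,field_char_0}"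
proof -
  obtain y where "y\<^sup>2 = x" using nth_root_exists[of 2 x] by auto
  then have "x = 4 * (y / 2)\<^sup>2" by (simp add: power_divide)
  then show ?thesis by (rule exI)
qed

lemma tb_bi_leonard_pair_parameters:
  fixes scale :: "'k::{alg_closed_field,field_char_0} \<Rightarrow> 'v::ab_group_add \<Rightarrow> 'v"
  assumes "tb_bi_leonard_pair scale d \<rho> \<rho>s V A As" "2 \<le> d"
  shows "even d" "\<rho> \<noteq> 0" "\<rho>s \<noteq> 0"
proof -
  obtain \<alpha> where \<rho>: "\<rho> = 4 * \<alpha>\<^sup>2" using ex_four_times_square by blast
  obtain \<beta> where \<rho>s: "\<rho>s = 4 * \<beta>\<^sup>2" using ex_four_times_square by blast
  have "even d \<and> \<alpha> \<noteq> 0 \<and> \<beta> \<noteq> 0"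
    by (rule tb_bi_leonard_pair_krawtchouk_basis[OF assms[unfolded \<rho> \<rho>s]]) (intro conjI)
  then show "even d" "\<rho> \<noteq> 0" "\<rho>s \<noteq> 0" by (simp_all add: \<rho> \<rho>s)
qed

theorem theorem8p18:
  fixes d :: nat
    and \<rho> \<rho>s :: "'k::{alg_closed_field,field_char_0}"
    and sV :: "'k \<Rightarrow> 'v::ab_group_add \<Rightarrow> 'v"
    and sW :: "'k \<Rightarrow> 'w::ab_group_add \<Rightarrow> 'w"
  assumes "d \<ge> 3"
  shows
    "((\<exists>V A As. tb_bi_leonard_pair seq_scale d \<rho> \<rho>s V A As)
        \<longleftrightarrow> even d \<and> \<rho> \<noteq> 0 \<and> \<rho>s \<noteq> 0) \<and>
     (\<forall>V A As. tb_bi_leonard_pair sV d \<rho> \<rho>s V A As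
        \<longrightarrow> even d \<and> \<rho> \<noteq> 0 \<and> \<rho>s \<noteq> 0) \<and>
     (\<forall>V A As W B Bs.
        tb_bi_leonard_pair sV d \<rho> \<rho>s V A As \<and>
        tb_bi_leonard_pair sW d \<rho> \<rho>s W B Bs
        \<longrightarrow> isomorphic_pairs sV V A As sW W B Bs)"
proof -
  have d2: "2 \<le> d" using assms by simp
  \<comment> \<open>The roots are fixed once, so that both pairs in the uniqueness claim are
    compared with the same normal form.\<close>
  obtain \<alpha> \<beta> where \<rho>: "\<rho> = 4 * \<alpha>\<^sup>2" and \<rho>s: "\<rho>s = 4 * \<beta>\<^sup>2"
    using ex_four_times_square[of \<rho>] ex_four_times_square[of \<rho>s] by blast
  have suff: "\<exists>V A As. tb_bi_leonard_pair seq_scale d \<rho> \<rho>s V A As" if "even d" "\<rho> \<noteq> 0" "\<rho>s \<noteq> 0"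
  proof -
    have nz: "\<alpha> \<noteq> 0" "\<beta> \<noteq> 0" using that by (auto simp: \<rho> \<rho>s)
    have "tb_bi_leonard_pair seq_scale d \<rho> \<rho>s (seq_space d) (seq_A \<alpha> d) (seq_As \<beta> d)"
      unfolding \<rho> \<rho>s
      by (rule krawtchouk_tb_bi_leonard_pair[OF vector_space_seq_scale unit_seq_basis(1)
            linear_map_on_seq_A linear_map_on_seq_As krawtchouk_basis_unit_seq
            krawtchouk_basis_coeff[OF that(1) nz(2)] nz that(1)])
    then show ?thesis by blast
  qed
  have iso: "isomorphic_pairs sV V A As sW W B Bs"
    if V: "tb_bi_leonard_pair sV d \<rho> \<rho>s V A As" and W: "tb_bi_leonard_pair sW d \<rho> \<rho>s W B Bs"
    for V A As W B Bs
  proof -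
    obtain v where v: "krawtchouk_basis sV V \<alpha> \<beta> A As v"
      by (rule tb_bi_leonard_pair_krawtchouk_basis[OF V[unfolded \<rho> \<rho>s] d2])
    obtain w where w: "krawtchouk_basis sW W \<alpha> \<beta> B Bs w"
      by (rule tb_bi_leonard_pair_krawtchouk_basis[OF W[unfolded \<rho> \<rho>s] d2])
    have "vector_space sV" "vector_space sW"
      "linear_map_on sV sV V V A" "linear_map_on sV sV V V As"
      "linear_map_on sW sW W W B" "linear_map_on sW sW W W Bs"
      "diameter sW W = diameter sV V"
      using V W by (simp_all add: tb_bi_leonard_pair_def leonard_pair_def)
    then show ?thesis by (rule krawtchouk_bases_isomorphic[OF _ _ _ _ _ _ _ v w])
  qed
  show ?thesis
  proof (intro conjI iffI allI impI)
    assume "\<exists>V A As. tb_bi_leonard_pair seq_scale d \<rho> \<rho>s V A As"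
    then obtain V :: "(nat \<Rightarrow> 'k) set" and A As where "tb_bi_leonard_pair seq_scale d \<rho> \<rho>s V A As"
      by blast
    from tb_bi_leonard_pair_parameters[OF this d2] show "even d" "\<rho> \<noteq> 0" "\<rho>s \<noteq> 0" .
  next
    fix V A As assume "tb_bi_leonard_pair sV d \<rho> \<rho>s V A As"
    from tb_bi_leonard_pair_parameters[OF this d2] show "even d" "\<rho> \<noteq> 0" "\<rho>s \<noteq> 0" .
  qed (use suff iso in blast)+
qed

end
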